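(* Let $n\ge 1$ and let $k\geq 0$ be an integer. Let $\Phi:\mathbb{R}^n\to\mathbb{R}$ be a measurable function and let $A(y)=(a_{ij}(y))_{n\times n}$ be a real $n\times n$ matrix depending measurably on $y\in\mathbb{R}^n$. Suppose that $$\int_{\mathbb{R}^n}|\det A(y)|^{-1}\left(1+\|A(y)\|^{k}\right)|\Phi(y)|\,\mathrm{d}y<\infty .$$ Then the Hausdorff operator $$H_{\Phi,A}f(x)=\int_{\mathbb{R}^n}\Phi(y)f(A(y)x)\,\mathrm{d}y$$ is bounded on the Sobolev space $W^{k,1}(\mathbb{R}^n)$. Moreover, for every $f\in W^{k,1}(\mathbb{R}^n)$ and every multi-index $\alpha=(\alpha_1,\dots,\alpha_n)$ with $|\alpha|\le k$, the weak derivative satisfies $$D^{\alpha}(H_{\Phi,A}f)(x)=\int_{\mathbb{R}^n}\Phi(y)\,D^{\alpha}_x\big(f(A(y)x)\big)\,\mathrm{d}y=\int_{\mathbb{R}^n}\Phi(y)\left(\left[\prod_{j=1}^n\left(\sum_{i=1}^n a_{ij}(y)\frac{\partial}{\partial x_i}\right)^{\alpha_j}\right]f\right)(A(y)x)\,\mathrm{d}y$$ for almost every $x$. In particular, if $k\ge 1$, then for $f\in W^{1,1}(\mathbb{R}^n)$ $$\nabla (H_{\Phi,A}f)(x)=\int_{\mathbb{R}^n}\Phi(y)\,(\nabla f)(A(y)x)\cdot A(y)\,\mathrm{d}y ,$$ and if $k\ge 2$, then for $f\in W^{2,1}(\mathbb{R}^n)$ $$\big(\partial_{ij}(H_{\Phi,A}f)(x)\big)_{n\times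 n}=\int_{\mathbb{R}^n}\Phi(y)\,A^{T}(y)\cdot\big((\partial_{ij}f)(A(y)x)\big)_{n\times n}\cdot A(y)\,\mathrm{d}y .$$
   Context: For an integer $k\ge 0$, $W^{k,1}(\mathbb{R}^n)$ is the space of $f\in L^1(\mathbb{R}^n)$ whose weak derivatives $D^\alpha f$ exist and belong to $L^1(\mathbb{R}^n)$ for all $|\alpha|\le k$, with norm $\|f\|_{W^{k,1}}=\sum_{|\alpha|\le k}\|D^\alpha f\|_{L^1}$ (so $W^{0,1}=L^1$). For a real matrix $B=(b_{ij})$, $\|B\|=\big(\sum_{i,j}|b_{ij}|^2\big)^{1/2}$. Gradients are row vectors, and $A^T$ is the transpose of $A$. $D_x^\alpha(f(A(y)x))$ is the weak derivative in $x$ of the function $x\mapsto f(A(y)x)$. In the integral hypothesis the integrand is taken to be $0$ where $\Phi(y)=0$ and $+\infty$ where $\Phi(y)\ne0$ and $\det A(y)=0$; thus $A(y)$ is invertible for almost every $y$ with $\Phi(y)\neq 0$. "$H_{\Phi,A}$ is bounded on $W^{k,1}(\mathbb{R}^n)$" means that for each $f\in W^{k,1}(\mathbb{R}^n)$ the integral defining $H_{\Phi,A}f(x)$ converges absolutely for almost every $x$, and there is a constant $C$ with $\|H_{\Phi,A}f\|_{W^{k,1}}\le C\|f\|_{W^{k,1}}$ for all $f\in W^{k,1}(\mathbb{R}^n)$. *)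

theory Defs
  imports "HOL-Analysis.Analysis" "HOL-Library.Poly_Mapping"
begin

section \<open>Multi-indices and classical derivatives of test functions\<close>

text \<open>Multi-indices are vectors of type \<open>nat ^ 'n\<close>; the unit multi-index of direction \<open>i\<close>
  is \<open>axis i 1\<close>.\<close>

definition mi_order :: "nat ^ 'n \<Rightarrow> nat" where
  "mi_order \<alpha> = (\<Sum>i\<in>UNIV. \<alpha> $ i)"

definition partial_deriv :: "'n \<Rightarrow> (real ^ 'n \<Rightarrow> real) \<Rightarrow> real ^ 'n \<Rightarrow> real" where
  "partial_deriv i \<phi> x = frechet_derivative \<phi> (at x) (axis i 1)"

primrec iter_partial :: "'n list \<Rightarrow> (real ^ 'n \<Rightarrow> real) \<Rightarrow> real ^ 'n \<Rightarrow> real" where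
  "iter_partial [] \<phi> = \<phi>"
| "iter_partial (i # is) \<phi> = partial_deriv i (iter_partial is \<phi>)"

text \<open>All iterated partial derivatives being differentiable everywhere makes them all
  continuous, so this is the usual \<open>C\<^sup>\<infinity>\<close> condition.\<close>

definition smooth :: "(real ^ 'n \<Rightarrow> real) \<Rightarrow> bool" where
  "smooth \<phi> \<longleftrightarrow> (\<forall>is x. iter_partial is \<phi> differentiable (at x))"

definition test_function :: "(real ^ 'n \<Rightarrow> real) \<Rightarrow> bool" where
  "test_function \<phi> \<longleftrightarrow> smooth \<phi> \<and> compact (closure {x. \<phi> x \<noteq> 0})"

text \<open>The index type carries no order, so one enumeration of \<open>\<alpha>\<close> as a list of directions is
  chosen; partial derivatives of a smooth function commute, so the choice is immaterial.\<close>

definition multi_deriv :: "nat ^ 'n \<Rightarrow> (real ^ 'n \<Rightarrow> real) \<Rightarrow> real ^ 'n \<Rightarrow> real" where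
  "multi_deriv \<alpha> \<phi> = iter_partial (SOME is. \<forall>i. count_list is i = \<alpha> $ i) \<phi>"

section \<open>Weak derivatives and the spaces \<open>W\<^sup>k\<^sup>,\<^sup>1\<close>\<close>

definition locally_integrable :: "(real ^ 'n \<Rightarrow> real) \<Rightarrow> bool" where
  "locally_integrable f \<longleftrightarrow> (\<forall>K. compact K \<longrightarrow> set_integrable lebesgue K f)"

definition has_weak_deriv ::
    "nat ^ 'n \<Rightarrow> (real ^ 'n \<Rightarrow> real) \<Rightarrow> (real ^ 'n \<Rightarrow> real) \<Rightarrow> bool" where
  "has_weak_deriv \<alpha> f g \<longleftrightarrow>
     locally_integrable f \<and> locally_integrable g \<and>
     (\<forall>\<phi>. test_function \<phi> \<longrightarrow>
        (LINT x|lebesgue. f x * multi_deriv \<alpha> \<phi> x) =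
        (- 1) ^ mi_order \<alpha> * (LINT x|lebesgue. g x * \<phi> x))"

text \<open>\<open>D\<^sup>\<alpha> f\<close> as a function: a representative, determined up to null sets. It is meaningful
  only where a weak derivative exists.\<close>

definition weak_D :: "nat ^ 'n \<Rightarrow> (real ^ 'n \<Rightarrow> real) \<Rightarrow> real ^ 'n \<Rightarrow> real" where
  "weak_D \<alpha> f = (SOME g. has_weak_deriv \<alpha> f g)"

text \<open>Elements are representatives, not classes modulo null sets.\<close>

definition sobolev_W1 :: "nat \<Rightarrow> (real ^ 'n \<Rightarrow> real) set" where
  "sobolev_W1 k = {f. integrable lebesgue f \<and>
     (\<forall>\<alpha>. mi_order \<alpha> \<le> k \<longrightarrow> (\<exists>g. has_weak_deriv \<alpha> f g \<and> integrable lebesgue g))}"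

definition sobolev_norm :: "nat \<Rightarrow> (real ^ 'n \<Rightarrow> real) \<Rightarrow> real" where
  "sobolev_norm k f = (\<Sum>\<alpha> | mi_order \<alpha> \<le> k. LINT x|lebesgue. \<bar>weak_D \<alpha> f x\<bar>)"

definition weak_grad :: "(real ^ 'n \<Rightarrow> real) \<Rightarrow> real ^ 'n \<Rightarrow> real ^ 'n" where
  "weak_grad f x = (\<chi> i. weak_D (axis i 1) f x)"

definition weak_hessian :: "(real ^ 'n \<Rightarrow> real) \<Rightarrow> real ^ 'n \<Rightarrow> real ^ 'n ^ 'n" where
  "weak_hessian f x = (\<chi> i j. weak_D (axis i 1 + axis j 1) f x)"

section \<open>Constant-coefficient differential operators\<close>

text \<open>An operator \<open>\<Sum>\<^sub>\<beta> c\<^sub>\<beta> D\<^sup>\<beta>\<close> is represented by its symbol, a polynomial in commuting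
  indeterminates (one per coordinate direction) given as a finitely supported map from
  multi-indices to coefficients. The product of symbols (convolution) corresponds to
  composition of operators.\<close>

definition apply_symbol ::
    "(nat ^ 'n \<Rightarrow>\<^sub>0 real) \<Rightarrow> (real ^ 'n \<Rightarrow> real) \<Rightarrow> real ^ 'n \<Rightarrow> real" where
  "apply_symbol P f x =
     (\<Sum>\<beta>\<in>Poly_Mapping.keys P. Poly_Mapping.lookup P \<beta> * weak_D \<beta> f x)"

text \<open>The symbol of \<open>\<Prod>\<^sub>j (\<Sum>\<^sub>i b\<^sub>i\<^sub>j \<partial>/\<partial>x\<^sub>i)\<close>, the \<open>j\<close>-th factor raised to the power \<open>\<alpha>\<^sub>j\<close>.\<close>

definition chain_symbol :: "real ^ 'n ^ 'n \<Rightarrow> nat ^ 'n \<Rightarrow> (nat ^ 'n \<Rightarrow>\<^sub>0 real)" where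
  "chain_symbol B \<alpha> =
     (\<Prod>j\<in>UNIV. (\<Sum>i\<in>UNIV. Poly_Mapping.single (axis i 1) (B $ i $ j)) ^ (\<alpha> $ j))"

section \<open>Hausdorff operators\<close>

definition hausdorff ::
    "(real ^ 'n \<Rightarrow> real) \<Rightarrow> (real ^ 'n \<Rightarrow> real ^ 'n ^ 'n) \<Rightarrow> (real ^ 'n \<Rightarrow> real) \<Rightarrow>
     real ^ 'n \<Rightarrow> real" where
  "hausdorff \<Phi> A f x = (LINT y|lebesgue. \<Phi> y * f (A y *v x))"

definition hausdorff_converges ::
    "(real ^ 'n \<Rightarrow> real) \<Rightarrow> (real ^ 'n \<Rightarrow> real ^ 'n ^ 'n) \<Rightarrow> (real ^ 'n \<Rightarrow> real) \<Rightarrow> bool" where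
  "hausdorff_converges \<Phi> A f \<longleftrightarrow>
     (AE x in lebesgue. integrable lebesgue (\<lambda>y. \<Phi> y * f (A y *v x)))"

definition hausdorff_bounded_on_W1 ::
    "nat \<Rightarrow> (real ^ 'n \<Rightarrow> real) \<Rightarrow> (real ^ 'n \<Rightarrow> real ^ 'n ^ 'n) \<Rightarrow> bool" where
  "hausdorff_bounded_on_W1 k \<Phi> A \<longleftrightarrow>
     (\<forall>f\<in>sobolev_W1 k. hausdorff_converges \<Phi> A f) \<and>
     (\<exists>C. \<forall>f\<in>sobolev_W1 k. hausdorff \<Phi> A f \<in> sobolev_W1 k \<and>
        sobolev_norm k (hausdorff \<Phi> A f) \<le> C * sobolev_norm k f)"

text \<open>\<open>norm\<close> on \<open>real ^ 'n ^ 'n\<close> is the Frobenius norm.\<close>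

definition hausdorff_weight ::
    "nat \<Rightarrow> (real ^ 'n \<Rightarrow> real) \<Rightarrow> (real ^ 'n \<Rightarrow> real ^ 'n ^ 'n) \<Rightarrow> real ^ 'n \<Rightarrow> ennreal" where
  "hausdorff_weight k \<Phi> A y =
     (if \<Phi> y = 0 then 0
      else if det (A y) = 0 then \<infinity>
      else ennreal (inverse \<bar>det (A y)\<bar> * (1 + norm (A y) ^ k) * \<bar>\<Phi> y\<bar>))"

text \<open>\<open>G y\<close> plays the role of \<open>D\<^sub>x\<^sup>\<alpha> (f (A(y) x))\<close>. For each \<open>y\<close> this is determined only up to a
  null set of \<open>x\<close>, which may depend on \<open>y\<close>; integrating over \<open>y\<close> at fixed \<open>x\<close> makes sense for
  versions for which the integrand is jointly measurable. Where \<open>\<Phi> y = 0\<close> the integrand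
  vanishes and \<open>G y\<close> is unconstrained.\<close>

definition dilated_deriv_version ::
    "(real ^ 'n \<Rightarrow> real) \<Rightarrow> (real ^ 'n \<Rightarrow> real ^ 'n ^ 'n) \<Rightarrow> nat ^ 'n \<Rightarrow> (real ^ 'n \<Rightarrow> real) \<Rightarrow>
     (real ^ 'n \<Rightarrow> real ^ 'n \<Rightarrow> real) \<Rightarrow> bool" where
  "dilated_deriv_version \<Phi> A \<alpha> f G \<longleftrightarrow>
     (\<lambda>(y, x). \<Phi> y * G y x) \<in> borel_measurable lebesgue \<and>
     (AE y in lebesgue. \<Phi> y \<noteq> 0 \<longrightarrow> has_weak_deriv \<alpha> (\<lambda>x. f (A y *v x)) (G y))"

end

theory Submission
  imports Defs
begin

text \<open>For invertible \<open>B\<close>, integration against a test function and the linear change of variables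
  \<open>z = B x\<close> move derivatives of \<open>f (B x)\<close> onto a test function, where the classical chain rule gives
  \<open>\<partial>\<^sub>j (\<psi> (B x)) = \<Sum>\<^sub>i b\<^sub>i\<^sub>j (\<partial>\<^sub>i \<psi>) (B x)\<close>; hence weak derivatives of dilations obey the chain rule
  \<open>D\<^sup>\<alpha> (f (B x)) = ([\<Prod>\<^sub>j (\<Sum>\<^sub>i b\<^sub>i\<^sub>j \<partial>\<^sub>i) ^ \<alpha>\<^sub>j] f) (B x)\<close>. The coefficients of that operator are
  bounded by \<open>\<parallel>B\<parallel> ^ \<bar>\<alpha>\<bar>\<close> and the dilation costs \<open>\<bar>det B\<bar>\<^bsup>-1\<^esup>\<close> in \<open>L\<^sup>1\<close>, so the weight hypothesis makes
  \<open>\<Phi>(y) D\<^sup>\<alpha>\<^sub>x (f (A(y) x))\<close> integrable in \<open>(y, x)\<close> jointly. Fubini's theorem then interchanges the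
  \<open>y\<close>-integral with the pairing against test functions.\<close>

section \<open>Derivatives of test functions along words of directions\<close>

text \<open>Three obstacles shape the proof. Elements of the Sobolev space and weak derivatives are
  representatives, fixed only up to null sets; f(A(y)x) inherits this because an invertible matrix
  pulls null sets back to null sets, but identities for fixed y then have exceptional sets that
  depend on y. Joint measurability turns them into identities for almost every pair (y, x). Next,
  Lebesgue measure on the product is the completion of the Borel product measure, and sections of a
  measurable function are measurable only for almost every y, so iterated integrals are computed on
  Borel versions. Finally, a multi-index does not say in which order derivatives are taken. Words of
  directions take its place: along a word the chain rule is a plain recursion, and symmetry of
  second derivatives on one side and commutative multiplication of symbols on the other lead back to
  multi-indices. Identifying \<open>weak_D\<close> with a formula rests on uniqueness of weak
  derivatives, hence on a supply of test functions, built from exp(-1/t).\<close>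

lemma partial_deriv_eq:
  "(f has_derivative f') (at x) \<Longrightarrow> partial_deriv i f x = f' (axis i 1)"
  unfolding partial_deriv_def by (simp add: frechet_derivative_at[symmetric])

lemma iter_partial_append: "iter_partial (v @ w) \<phi> = iter_partial v (iter_partial w \<phi>)"
  by (induction v) auto

lemma smooth_iter_partial: "smooth \<phi> \<Longrightarrow> smooth (iter_partial w \<phi>)"
  unfolding smooth_def by (metis iter_partial_append)

lemma smooth_has_derivative:
  assumes "smooth \<phi>"
  shows "(iter_partial w \<phi> has_derivative (\<lambda>v. \<Sum>i\<in>UNIV. v $ i * iter_partial (i # w) \<phi> x)) (at x)"
proof -
  let ?g = "iter_partial w \<phi>"
  let ?D = "frechet_derivative ?g (at x)"
  have D: "(?g has_derivative ?D) (at x)"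
    using assms unfolding smooth_def by (simp add: frechet_derivative_works)
  interpret bounded_linear ?D using D by (rule has_derivative_bounded_linear)
  have "?D v = (\<Sum>i\<in>UNIV. v $ i * iter_partial (i # w) \<phi> x)" for v
  proof -
    have "?D v = ?D (\<Sum>i\<in>UNIV. v $ i *\<^sub>R axis i 1)"
      using basis_expansion[of v] by (simp add: scalar_mult_eq_scaleR)
    also have "\<dots> = (\<Sum>i\<in>UNIV. v $ i * iter_partial (i # w) \<phi> x)"
      by (simp add: sum scaleR partial_deriv_def)
    finally show ?thesis .
  qed
  then have "?D = (\<lambda>v. \<Sum>i\<in>UNIV. v $ i * iter_partial (i # w) \<phi> x)" by auto
  with D show ?thesis by simp
qed

lemma smooth_continuous_on: "smooth \<phi> \<Longrightarrow> continuous_on S (iter_partial w \<phi>)"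
  by (meson continuous_at_imp_continuous_on differentiable_imp_continuous_within smooth_def)

lemma smooth_partial_line:
  fixes \<phi> :: "real ^ 'n \<Rightarrow> real"
  assumes "smooth \<phi>"
  shows "((\<lambda>s. iter_partial w \<phi> (y + s *\<^sub>R axis i 1)) has_real_derivative
           iter_partial (i # w) \<phi> (y + s *\<^sub>R axis i 1)) (at s)"
proof -
  have "((\<lambda>s. y + s *\<^sub>R (axis i 1 :: real^'n)) has_derivative (\<lambda>t. t *\<^sub>R axis i 1)) (at s)"
    by (auto intro!: derivative_eq_intros)
  from has_derivative_compose[OF this smooth_has_derivative[OF assms]]
  have "((\<lambda>s. iter_partial w \<phi> (y + s *\<^sub>R axis i 1)) has_derivative
      (\<lambda>t. \<Sum>k\<in>UNIV. (t *\<^sub>R axis i 1) $ k * iter_partial (k # w) \<phi> (y + s *\<^sub>R axis i 1))) (at s)" .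
  moreover have "(\<Sum>k\<in>UNIV. (t *\<^sub>R axis i 1) $ k * iter_partial (k # w) \<phi> (y + s *\<^sub>R axis i 1))
      = iter_partial (i # w) \<phi> (y + s *\<^sub>R axis i 1) * t" for t
    by (subst sum.remove[of _ i]) (auto simp: axis_def intro!: sum.neutral)
  ultimately show ?thesis
    by (simp add: has_field_derivative_def)
qed

text \<open>Two mean value steps: one along direction i for the increment \<open>u\<close> across a
  step in direction j, then one along j for the first partial derivative. The second difference is
  symmetric in i and j, while the right side records the order of differentiation.\<close>

lemma second_difference_mvt:
  assumes "smooth \<phi>" "0 < h"
  shows "\<exists>s t. 0 < s \<and> s < h \<and> 0 < t \<and> t < h \<and>
    \<phi> (x + h *\<^sub>R axis i 1 + h *\<^sub>R axis j 1) - \<phi> (x + h *\<^sub>R axis i 1) - \<phi> (x + h *\<^sub>R axis j 1) + \<phi> x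
    = h * h * iter_partial [j, i] \<phi> (x + s *\<^sub>R axis i 1 + t *\<^sub>R axis j 1)"
proof -
  define u where "u s = \<phi> ((x + h *\<^sub>R axis j 1) + s *\<^sub>R axis i 1) - \<phi> (x + s *\<^sub>R axis i 1)" for s
  have "(u has_real_derivative
     (iter_partial [i] \<phi> ((x + h *\<^sub>R axis j 1) + s *\<^sub>R axis i 1) - iter_partial [i] \<phi> (x + s *\<^sub>R axis i 1))) (at s)"
    for s
    unfolding u_def using smooth_partial_line[OF assms(1), of "[]"] by (intro DERIV_diff) auto
  from MVT2[OF assms(2) this] obtain s where s: "0 < s" "s < h" "u h - u 0 = h *
     (iter_partial [i] \<phi> ((x + h *\<^sub>R axis j 1) + s *\<^sub>R axis i 1) - iter_partial [i] \<phi> (x + s *\<^sub>R axis i 1))"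
    by auto
  from MVT2[OF assms(2) smooth_partial_line[OF assms(1), of "[i]" "x + s *\<^sub>R axis i 1" j]]
  obtain t where "0 < t" "t < h"
    "iter_partial [i] \<phi> (x + s *\<^sub>R axis i 1 + h *\<^sub>R axis j 1) - iter_partial [i] \<phi> (x + s *\<^sub>R axis i 1)
      = h * iter_partial [j, i] \<phi> (x + s *\<^sub>R axis i 1 + t *\<^sub>R axis j 1)"
    by auto
  with s show ?thesis
    unfolding u_def by (intro exI[of _ s] exI[of _ t]) (simp add: algebra_simps)
qed

text \<open>The second difference with step \<open>h n\<close> equals \<open>h n * h n\<close> times
  either mixed derivative, each at its own intermediate point. Both points tend to x, and the mixed
  derivatives are continuous.\<close>

lemma partial_deriv_commute:
  assumes "smooth \<phi>"
  shows "partial_deriv i (partial_deriv j \<phi>) = partial_deriv j (partial_deriv i \<phi>)"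
proof
  fix x
  define h where "h n = inverse (real (Suc n))" for n
  have hpos: "0 < h n" for n by (simp add: h_def)
  have "\<forall>n. \<exists>s t. 0 < s \<and> s < h n \<and> 0 < t \<and> t < h n \<and>
    \<phi> (x + h n *\<^sub>R axis i 1 + h n *\<^sub>R axis j 1) - \<phi> (x + h n *\<^sub>R axis i 1) - \<phi> (x + h n *\<^sub>R axis j 1) + \<phi> x
    = h n * h n * iter_partial [j, i] \<phi> (x + s *\<^sub>R axis i 1 + t *\<^sub>R axis j 1)"
    using second_difference_mvt[OF assms hpos] by blast
  then obtain s t where st: "\<And>n. 0 < s n" "\<And>n. s n < h n" "\<And>n. 0 < t n" "\<And>n. t n < h n"
    "\<And>n. \<phi> (x + h n *\<^sub>R axis i 1 + h n *\<^sub>R axis j 1) - \<phi> (x + h n *\<^sub>R axis i 1) - \<phi> (x + h n *\<^sub>R axis j 1) + \<phi> x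
    = h n * h n * iter_partial [j, i] \<phi> (x + s n *\<^sub>R axis i 1 + t n *\<^sub>R axis j 1)"
    by metis
  have "\<forall>n. \<exists>s t. 0 < s \<and> s < h n \<and> 0 < t \<and> t < h n \<and>
    \<phi> (x + h n *\<^sub>R axis j 1 + h n *\<^sub>R axis i 1) - \<phi> (x + h n *\<^sub>R axis j 1) - \<phi> (x + h n *\<^sub>R axis i 1) + \<phi> x
    = h n * h n * iter_partial [i, j] \<phi> (x + s *\<^sub>R axis j 1 + t *\<^sub>R axis i 1)"
    using second_difference_mvt[OF assms hpos] by blast
  then obtain s' t' where st': "\<And>n. 0 < s' n" "\<And>n. s' n < h n" "\<And>n. 0 < t' n" "\<And>n. t' n < h n"
    "\<And>n. \<phi> (x + h n *\<^sub>R axis j 1 + h n *\<^sub>R axis i 1) - \<phi> (x + h n *\<^sub>R axis j 1) - \<phi> (x + h n *\<^sub>R axis i 1) + \<phi> x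
    = h n * h n * iter_partial [i, j] \<phi> (x + s' n *\<^sub>R axis j 1 + t' n *\<^sub>R axis i 1)"
    by metis
  have eq: "iter_partial [j, i] \<phi> (x + s n *\<^sub>R axis i 1 + t n *\<^sub>R axis j 1)
     = iter_partial [i, j] \<phi> (x + s' n *\<^sub>R axis j 1 + t' n *\<^sub>R axis i 1)" for n
  proof -
    have "h n * h n * iter_partial [j, i] \<phi> (x + s n *\<^sub>R axis i 1 + t n *\<^sub>R axis j 1)
     = h n * h n * iter_partial [i, j] \<phi> (x + s' n *\<^sub>R axis j 1 + t' n *\<^sub>R axis i 1)"
      unfolding st(5)[symmetric] st'(5)[symmetric] by (simp add: algebra_simps)
    then show ?thesis using hpos[of n] by simp
  qed
  have h0: "h \<longlonglongrightarrow> 0" unfolding h_def by (rule LIMSEQ_inverse_real_of_nat)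
  have small: "a \<longlonglongrightarrow> 0" if "\<And>n. 0 < a n" "\<And>n. a n < h n" for a
    by (rule tendsto_sandwich[OF _ _ tendsto_const h0]) (use that in \<open>auto intro!: always_eventually less_imp_le\<close>)
  have lim: "(\<lambda>n. iter_partial [k, l] \<phi> (x + a n *\<^sub>R axis p 1 + b n *\<^sub>R axis q 1)) \<longlonglongrightarrow> iter_partial [k, l] \<phi> x"
    if "\<And>n. 0 < a n" "\<And>n. a n < h n" "\<And>n. 0 < b n" "\<And>n. b n < h n" for a b k l p q
  proof -
    have "(\<lambda>n. x + a n *\<^sub>R axis p 1 + b n *\<^sub>R axis q 1) \<longlonglongrightarrow> x + 0 *\<^sub>R axis p 1 + 0 *\<^sub>R axis q 1"
      by (intro tendsto_intros small that)
    then have "(\<lambda>n. x + a n *\<^sub>R axis p 1 + b n *\<^sub>R axis q 1) \<longlonglongrightarrow> x" by simp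
    moreover have "isCont (iter_partial [k, l] \<phi>) x"
      using smooth_continuous_on[OF assms, of UNIV "[k,l]"] by (simp add: continuous_on_eq_continuous_at)
    ultimately show ?thesis by (rule isCont_tendsto_compose[rotated])
  qed
  have "iter_partial [j, i] \<phi> x = iter_partial [i, j] \<phi> x"
    using lim[OF st(1-4), of j i i j] lim[OF st'(1-4), of i j j i]
    unfolding eq by (rule LIMSEQ_unique)
  then show "partial_deriv i (partial_deriv j \<phi>) x = partial_deriv j (partial_deriv i \<phi>) x" by simp
qed

lemma iter_partial_move_to_front:
  assumes "smooth \<phi>"
  shows "iter_partial (a @ i # b) \<phi> = iter_partial (i # a @ b) \<phi>"
proof (induction a)
  case (Cons c a)
  then show ?case
    using partial_deriv_commute[OF smooth_iter_partial[OF assms, of "a @ b"]] by simp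
qed simp

lemma iter_partial_permute:
  assumes "smooth \<phi>"
  shows "mset v = mset w \<Longrightarrow> iter_partial v \<phi> = iter_partial w \<phi>"
proof (induction v arbitrary: w)
  case (Cons i v)
  then have "i \<in> set w" by (metis list.set_intros(1) set_mset_mset)
  then obtain a b where w: "w = a @ i # b" by (meson split_list)
  with Cons.prems have "mset v = mset (a @ b)" by simp
  then have "iter_partial v \<phi> = iter_partial (a @ b) \<phi>" by (rule Cons.IH)
  then show ?case unfolding w iter_partial_move_to_front[OF assms] by simp
qed simp

section \<open>Multi-indices as words of directions up to rearrangement\<close>

definition word_index :: "'n list \<Rightarrow> nat ^ 'n" where
  "word_index w = (\<chi> i. count_list w i)"

lemma word_index_Nil [simp]: "word_index [] = 0"
  and word_index_Cons: "word_index (i # w) = word_index w + axis i 1"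
  by (auto simp: word_index_def vec_eq_iff axis_def)

lemma mi_order_word_index: "mi_order (word_index (w :: 'n::finite list)) = length w"
  by (induction w) (auto simp: mi_order_def word_index_Cons sum.distrib axis_def)

lemma ex_word_index: "\<exists>w. word_index w = (\<alpha> :: nat ^ 'n)"
proof -
  obtain w :: "'n list" where w: "mset w = (\<Sum>j\<in>UNIV. replicate_mset (\<alpha> $ j) j)"
    using ex_mset by blast
  have "count_list w i = \<alpha> $ i" for i
  proof -
    have "count_list w i = count (mset w) i" by (simp add: count_mset)
    also have "\<dots> = (\<Sum>j\<in>UNIV. if j = i then \<alpha> $ j else 0)"
      unfolding w count_sum by (auto intro!: sum.cong)
    finally show ?thesis by simp
  qed
  then show ?thesis by (auto simp: word_index_def vec_eq_iff)
qed

text \<open>The enumeration chosen inside \<open>multi_deriv\<close> has the same letters with the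
  same multiplicities as w, and iterated partials of a smooth function depend only on that multiset.
  From here on the choice can be made as convenient.\<close>

lemma multi_deriv_word_index:
  assumes "smooth \<phi>"
  shows "multi_deriv (word_index w) \<phi> = iter_partial w \<phi>"
proof -
  have "\<forall>i. count_list (SOME is. \<forall>i. count_list is i = word_index w $ i) i = word_index w $ i"
    by (rule someI[of _ w]) (simp add: word_index_def)
  then have "mset (SOME is. \<forall>i. count_list is i = word_index w $ i) = mset w"
    by (intro multiset_eqI) (simp add: word_index_def count_mset)
  then show ?thesis
    unfolding multi_deriv_def by (rule iter_partial_permute[OF assms])
qed

text \<open>Words of directions index noncommuting monomials: with \<open>u w\<close> the derivative along the word \<open>w\<close>,
  \<open>word_sum B L u\<close> is the expansion of \<open>\<Prod>\<^sub>j (\<Sum>\<^sub>i b\<^sub>i\<^sub>j \<partial>\<^sub>i)\<close>, \<open>j\<close> running through \<open>L\<close>. Recursion on \<open>L\<close>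
  replaces computations with the coefficients of the symbol.\<close>

primrec word_sum :: "real ^ 'n ^ 'n \<Rightarrow> 'n list \<Rightarrow> ('n list \<Rightarrow> real) \<Rightarrow> real" where
  "word_sum B [] u = u []"
| "word_sum B (j # L) u = (\<Sum>i\<in>UNIV. B $ i $ j * word_sum B L (\<lambda>w. u (i # w)))"

lemma has_derivative_word_sum:
  assumes "\<And>w. ((\<lambda>x. u x w) has_derivative (\<lambda>v. u' v w)) F"
  shows "((\<lambda>x. word_sum B L (u x)) has_derivative (\<lambda>v. word_sum B L (u' v))) F"
  using assms
proof (induction L arbitrary: u u')
  case (Cons j L)
  show ?case
    unfolding word_sum.simps
    by (intro has_derivative_sum has_derivative_mult_right Cons.IH Cons.prems)
qed simp

lemma word_sum_sum:
  "word_sum B L (\<lambda>w. \<Sum>i\<in>S. c i * u i w) = (\<Sum>i\<in>S. c i * word_sum B L (u i))"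
proof (induction L arbitrary: u)
  case (Cons j L)
  show ?case
    unfolding word_sum.simps Cons
    by (simp add: sum_distrib_left mult.left_commute sum.swap[of _ _ S])
qed simp

text \<open>The head of L is the outermost derivative on the left and the outermost factor on the
  right, so an induction step is one differentiation in direction j. The vector B e_j has components
  b_ij, and \<open>word_sum_sum\<close> pulls the resulting sum over i to the front.
  Differentiability is obtained from the same formula.\<close>

lemma iter_partial_compose_matrix:
  assumes "smooth \<phi>"
  shows "iter_partial L (\<lambda>x. \<phi> (B *v x)) = (\<lambda>x. word_sum B L (\<lambda>w. iter_partial w \<phi> (B *v x)))"
    and "iter_partial L (\<lambda>x. \<phi> (B *v x)) differentiable (at x)"
proof -
  have der: "((\<lambda>x. iter_partial w \<phi> (B *v x)) has_derivative
      (\<lambda>v. \<Sum>i\<in>UNIV. (B *v v) $ i * iter_partial (i # w) \<phi> (B *v x))) (at x)" for w x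
    by (rule has_derivative_compose[OF _ smooth_has_derivative[OF assms]])
       (simp add: bounded_linear_imp_has_derivative matrix_vector_mul_bounded_linear)
  note der_sum = has_derivative_word_sum[OF der]
  show eq: "iter_partial L (\<lambda>x. \<phi> (B *v x)) = (\<lambda>x. word_sum B L (\<lambda>w. iter_partial w \<phi> (B *v x)))" for L
  proof (induction L)
    case (Cons j L)
    show ?case
    proof
      fix x
      have "iter_partial (j # L) (\<lambda>x. \<phi> (B *v x)) x
          = word_sum B L (\<lambda>w. \<Sum>i\<in>UNIV. (B *v axis j 1) $ i * iter_partial (i # w) \<phi> (B *v x))"
        unfolding iter_partial.simps(2) Cons by (rule partial_deriv_eq[OF der_sum, unfolded iter_partial.simps(2)])
      also have "\<dots> = (\<Sum>i\<in>UNIV. B $ i $ j * word_sum B L (\<lambda>w. iter_partial (i # w) \<phi> (B *v x)))"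
        unfolding word_sum_sum by (simp add: matrix_vector_mult_basis column_def)
      finally show "iter_partial (j # L) (\<lambda>x. \<phi> (B *v x)) x
          = word_sum B (j # L) (\<lambda>w. iter_partial w \<phi> (B *v x))" by simp
    qed
  qed simp
  show "iter_partial L (\<lambda>x. \<phi> (B *v x)) differentiable (at x)"
    unfolding eq differentiable_def by (rule exI) (rule der_sum)
qed

lemma test_function_compose_matrix:
  fixes B :: "real ^ 'n ^ 'n"
  assumes "test_function \<phi>" "invertible B"
  shows "test_function (\<lambda>x. \<phi> (B *v x))"
  unfolding test_function_def
proof
  show "smooth (\<lambda>x. \<phi> (B *v x))"
    unfolding smooth_def[of "\<lambda>x. \<phi> (B *v x)"]
    using iter_partial_compose_matrix(2) assms(1)[unfolded test_function_def] by blast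
  obtain C where C: "C ** B = mat 1"
    using assms(2) by (auto simp: invertible_def)
  have "bounded {x. \<phi> x \<noteq> 0}"
    using assms(1) unfolding test_function_def
    by (blast intro: bounded_subset[OF compact_imp_bounded closure_subset])
  then have "bounded ((*v) (C) ` {x. \<phi> x \<noteq> 0})"
    by (rule bounded_linear_image[OF _ matrix_vector_mul_bounded_linear])
  \<comment> \<open>Invertibility enters for compact support: the support is carried back by the
    inverse C, whereas a singular B would spread it along its kernel.\<close>
  moreover have "{x. \<phi> (B *v x) \<noteq> 0} \<subseteq> (*v) (C) ` {x. \<phi> x \<noteq> 0}"
  proof
    fix x assume "x \<in> {x. \<phi> (B *v x) \<noteq> 0}"
    moreover have "x = C *v (B *v x)"
      using C by (simp add: matrix_vector_mul_assoc)
    ultimately show "x \<in> (*v) (C) ` {x. \<phi> x \<noteq> 0}" by blast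
  qed
  ultimately show "compact (closure {x. \<phi> (B *v x) \<noteq> 0})"
    by (meson bounded_subset compact_closure)
qed

text \<open>The complement of the closed support is open, so a function that vanishes there also has
  vanishing derivative there.\<close>

lemma iter_partial_support:
  assumes "smooth \<phi>"
  shows "{x. iter_partial w \<phi> x \<noteq> 0} \<subseteq> closure {x. \<phi> x \<noteq> 0}"
proof (induction w)
  case (Cons i w)
  have "iter_partial (i # w) \<phi> x = 0" if "x \<notin> closure {x. \<phi> x \<noteq> 0}" for x
  proof -
    have "(iter_partial w \<phi> has_derivative (\<lambda>_. 0)) (at x)"
      by (rule has_derivative_transform_within_open[OF has_derivative_const[of 0], of "- closure {x. \<phi> x \<noteq> 0}"])
         (use that Cons in auto)
    then show ?thesis by (simp add: partial_deriv_eq)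
  qed
  then show ?case by blast
qed (auto intro: subsetD[OF closure_subset])

lemma test_function_iter_partial:
  assumes "test_function \<phi>"
  shows "test_function (iter_partial w \<phi>)"
proof -
  have \<phi>: "smooth \<phi>" "compact (closure {x. \<phi> x \<noteq> 0})"
    using assms by (simp_all add: test_function_def)
  then have "bounded {x. iter_partial w \<phi> x \<noteq> 0}"
    by (intro bounded_subset[OF compact_imp_bounded iter_partial_support])
  then show ?thesis
    using smooth_iter_partial[OF \<phi>(1)] by (simp add: test_function_def)
qed

lemma test_function_bounded:
  assumes "test_function \<phi>"
  obtains M where "\<And>x. \<bar>\<phi> x\<bar> \<le> M"
proof -
  define K where "K = closure {x. \<phi> x \<noteq> 0}"
  have "smooth \<phi>" "compact K"
    using assms by (simp_all add: test_function_def K_def)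
  moreover from this have "continuous_on K \<phi>"
    using smooth_continuous_on[of \<phi> K "[]"] by simp
  ultimately have "bounded (\<phi> ` K)"
    by (intro compact_imp_bounded compact_continuous_image)
  then obtain M where "\<forall>y\<in>\<phi> ` K. norm y \<le> M"
    unfolding bounded_iff by blast
  then have M: "\<And>x. x \<in> K \<Longrightarrow> \<bar>\<phi> x\<bar> \<le> M" by simp
  \<comment> \<open>The maximum with 0 handles points off K and the case of empty K, in which M may
    be negative.\<close>
  have "\<bar>\<phi> x\<bar> \<le> max M 0" for x
  proof (cases "\<phi> x = 0")
    case False
    then have "x \<in> K" unfolding K_def by (intro subsetD[OF closure_subset]) simp
    then show ?thesis using M[of x] by linarith
  qed simp
  then show ?thesis by (rule that)
qed

lemma test_function_measurable: "test_function \<phi> \<Longrightarrow> \<phi> \<in> borel_measurable borel"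
  using smooth_continuous_on[of \<phi> UNIV "[]"] by (simp add: test_function_def borel_measurable_continuous_onI)

section \<open>Bump functions\<close>

lemma partial_deriv_add:
  assumes "f differentiable (at x)" "g differentiable (at x)"
  shows "partial_deriv i (\<lambda>x. f x + g x) x = partial_deriv i f x + partial_deriv i g x"
  using partial_deriv_eq[OF has_derivative_add[OF assms[unfolded frechet_derivative_works]]]
  by (simp add: partial_deriv_def)

lemma partial_deriv_mult:
  assumes "f differentiable (at x)" "g differentiable (at x)"
  shows "partial_deriv i (\<lambda>x. f x * g x) x = f x * partial_deriv i g x + partial_deriv i f x * g x"
  using partial_deriv_eq[OF has_derivative_mult[OF assms[unfolded frechet_derivative_works]]]
  by (simp add: partial_deriv_def)

text \<open>Differentiability is asked only up to length n because the lemma serves inside the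
  induction for products, where at stage n nothing more is known about the two summands.\<close>

lemma iter_partial_add:
  assumes "\<And>w x. length w \<le> n \<Longrightarrow> iter_partial w f differentiable (at x)"
    and "\<And>w x. length w \<le> n \<Longrightarrow> iter_partial w g differentiable (at x)"
  shows "length w \<le> Suc n \<Longrightarrow>
    iter_partial w (\<lambda>x. f x + g x) = (\<lambda>x. iter_partial w f x + iter_partial w g x)"
proof (induction w)
  case (Cons i w)
  then have "length w \<le> n" and
    eq: "iter_partial w (\<lambda>x. f x + g x) = (\<lambda>x. iter_partial w f x + iter_partial w g x)" by auto
  then show ?case
    unfolding iter_partial.simps eq using assms by (simp add: fun_eq_iff partial_deriv_add)
qed simp

lemma smooth_differentiable: "smooth f \<Longrightarrow> iter_partial w f differentiable (at x)"
  by (simp add: smooth_def)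

text \<open>Induction on a length bound, for all pairs of smooth functions at once. The last letter
  of a word acts first, so splitting the word at its end applies the Leibniz rule to f g itself and
  leaves a sum of two products of smooth functions under a shorter word.\<close>

lemma smooth_mult:
  fixes f g :: "real ^ 'n \<Rightarrow> real"
  assumes "smooth f" "smooth g"
  shows "smooth (\<lambda>x. f x * g x)"
proof -
  have "\<forall>(f :: real ^ 'n \<Rightarrow> real) g w x. smooth f \<longrightarrow> smooth g \<longrightarrow> length w \<le> n \<longrightarrow>
      iter_partial w (\<lambda>x. f x * g x) differentiable (at x)" for n
  proof (induction n)
    case 0
    then show ?case
      using smooth_differentiable[of _ "[]"] by (auto intro!: derivative_intros)
  next
    case (Suc n)
    show ?case
    proof (intro allI impI)
      fix f g :: "real ^ 'n \<Rightarrow> real" and w :: "'n list" and x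
      assume fg: "smooth f" "smooth g" and w: "length w \<le> Suc n"
      show "iter_partial w (\<lambda>x. f x * g x) differentiable (at x)"
      proof (cases w rule: rev_cases)
        case Nil
        then show ?thesis using Suc fg by (metis list.size(3) le0)
      next
        case (snoc v i)
        have fg': "smooth (partial_deriv i f)" "smooth (partial_deriv i g)"
          using smooth_iter_partial[of _ "[i]"] fg by auto
        have deriv: "partial_deriv i (\<lambda>x. f x * g x) = (\<lambda>x. f x * partial_deriv i g x + partial_deriv i f x * g x)"
          using smooth_differentiable[of _ "[]"] fg by (intro ext partial_deriv_mult) auto
        have "iter_partial w (\<lambda>x. f x * g x)
            = iter_partial v (\<lambda>x. f x * partial_deriv i g x + partial_deriv i f x * g x)"
          unfolding snoc iter_partial_append by (simp add: deriv)
        also have "\<dots> = (\<lambda>x. iter_partial v (\<lambda>x. f x * partial_deriv i g x) x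
            + iter_partial v (\<lambda>x. partial_deriv i f x * g x) x)"
          by (rule iter_partial_add[where n = n]) (use Suc fg fg' w snoc in auto)
        finally show ?thesis
          using Suc fg fg' w snoc by (auto intro!: derivative_intros)
      qed
    qed
  qed
  then show ?thesis
    using assms unfolding smooth_def[of "\<lambda>x. f x * g x"] by blast
qed

lemma smooth_const: "smooth (\<lambda>x. c)"
proof -
  have "\<exists>d. iter_partial w (\<lambda>x::real^'a. c) = (\<lambda>x. d)" for w
  proof (induction w)
    case (Cons i w)
    then obtain d where "iter_partial w (\<lambda>x::real^'a. c) = (\<lambda>x. d)" ..
    then show ?case by (auto simp: partial_deriv_eq[OF has_derivative_const])
  qed auto
  then show ?thesis
    unfolding smooth_def by (metis differentiable_const)
qed

lemma smooth_prod:
  assumes "finite I" "\<And>i. i \<in> I \<Longrightarrow> smooth (f i)"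
  shows "smooth (\<lambda>x. \<Prod>i\<in>I. f i x)"
  using assms by (induction I) (auto simp: smooth_const smooth_mult)

text \<open>F is a tower of successive derivatives of one function of one variable. Each partial
  derivative moves one step up the tower and contributes a constant factor: c in direction i and 0
  in any other direction.\<close>

lemma smooth_coordinate_affine:
  fixes F :: "nat \<Rightarrow> real \<Rightarrow> real"
  assumes F: "\<And>m t. (F m has_real_derivative F (Suc m) t) (at t)"
  shows "smooth (\<lambda>x::real^'n. F 0 (c * x $ i + e))"
proof -
  have der: "((\<lambda>x::real^'n. a * F m (c * x $ i + e)) has_derivative
      (\<lambda>v. a * (F (Suc m) (c * x $ i + e) * (c * v $ i)))) (at x)" for a m x
  proof -
    have "((\<lambda>x::real^'n. c * x $ i + e) has_derivative (\<lambda>v. c * v $ i)) (at x)"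
      by (auto intro!: derivative_eq_intros bounded_linear_imp_has_derivative[OF bounded_linear_vec_nth])
    from has_derivative_compose[OF this F[unfolded has_field_derivative_def]]
    show ?thesis by (rule has_derivative_mult_right)
  qed
  have "\<exists>a. iter_partial w (\<lambda>x::real^'n. F 0 (c * x $ i + e)) = (\<lambda>x. a * F (length w) (c * x $ i + e))" for w
  proof (induction w)
    case Nil
    show ?case by (rule exI[of _ 1]) simp
  next
    case (Cons j w)
    then obtain a where eq: "iter_partial w (\<lambda>x::real^'n. F 0 (c * x $ i + e)) = (\<lambda>x. a * F (length w) (c * x $ i + e))" ..
    show ?case
      unfolding iter_partial.simps eq by (intro exI[of _ "a * (c * axis j 1 $ i)"]) (auto simp: partial_deriv_eq[OF der] fun_eq_iff)
  qed
  then show ?thesis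
    unfolding smooth_def using der by (metis differentiable_def)
qed

text \<open>For a polynomial \<open>p\<close>, the functions \<open>p(1/t) exp(-1/t)\<close> extended by zero are closed under
  differentiation.\<close>

definition flat_step :: "real poly \<Rightarrow> real \<Rightarrow> real" where
  "flat_step p t = (if t > 0 then poly p (inverse t) * exp (- inverse t) else 0)"

lemma poly_times_exp_minus_tendsto_0: "((\<lambda>z. poly p z * exp (- z)) \<longlongrightarrow> 0) (at_top :: real filter)"
proof -
  have "((\<lambda>z. \<Sum>i\<le>degree p. coeff p i * (z ^ i / exp z)) \<longlongrightarrow> 0) (at_top :: real filter)"
    by (intro tendsto_null_sum tendsto_mult_right_zero tendsto_power_div_exp_0)
  then show ?thesis
    by (simp add: poly_altdef sum_distrib_right exp_minus divide_inverse mult.assoc)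
qed

text \<open>With z = 1/t, differentiating p(z) exp(-z) in t gives z^2 (p - p')(z) exp(-z); the
  polynomial \<open>[:0, 0, 1:]\<close> is the factor z^2. At t = 0 the right difference quotient is
  z p(z) exp(-z) with z tending to infinity, and the left one is 0.\<close>

lemma flat_step_has_derivative:
  "(flat_step p has_real_derivative flat_step ([:0, 0, 1:] * (p - pderiv p)) t) (at t)"
proof (cases t "0 :: real" rule: linorder_cases)
  case less
  have "((\<lambda>_. 0) has_real_derivative 0) (at t)" by simp
  then have "(flat_step p has_real_derivative 0) (at t)"
    by (rule has_field_derivative_transform_within_open[where S = "{..<0}"]) (use less in \<open>auto simp: flat_step_def\<close>)
  then show ?thesis using less by (simp add: flat_step_def)
next
  case greater
  have "((\<lambda>t. poly p (inverse t) * exp (- inverse t)) has_real_derivative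
      flat_step ([:0, 0, 1:] * (p - pderiv p)) t) (at t)"
    using greater unfolding flat_step_def
    by (auto intro!: derivative_eq_intros DERIV_chain'[OF _ poly_DERIV] simp: field_simps power2_eq_square)
  then show ?thesis
    by (rule has_field_derivative_transform_within_open[where S = "{0<..}"]) (use greater in \<open>auto simp: flat_step_def\<close>)
next
  case equal
  have "((\<lambda>z. poly ([:0, 1:] * p) z * exp (- z)) \<longlongrightarrow> 0) at_top"
    by (rule poly_times_exp_minus_tendsto_0)
  then have "((\<lambda>z. flat_step p (inverse z) / inverse z) \<longlongrightarrow> 0) at_top"
    by (rule Lim_transform_eventually)
       (use eventually_gt_at_top[of 0] in eventually_elim, simp add: flat_step_def field_simps)
  then have "((\<lambda>h. flat_step p h / h) \<longlongrightarrow> 0) (at_right 0)"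
    unfolding filterlim_at_right_to_top .
  moreover have "((\<lambda>h. flat_step p h / h) \<longlongrightarrow> 0) (at_left 0)"
    by (rule Lim_transform_eventually[OF tendsto_const])
       (auto simp: flat_step_def eventually_at_left_field intro!: exI[of _ "-1"])
  ultimately have "((\<lambda>h. flat_step p h / h) \<longlongrightarrow> 0) (at 0)"
    by (simp add: filterlim_at_split)
  then show ?thesis
    using equal by (simp add: DERIV_def flat_step_def)
qed

lemma smooth_flat_step: "smooth (\<lambda>x::real^'n. flat_step p (c * x $ i + e))"
proof -
  define F where "F m = flat_step (((\<lambda>p. [:0, 0, 1:] * (p - pderiv p)) ^^ m) p)" for m
  have "(F m has_real_derivative F (Suc m) t) (at t)" for m t
    unfolding F_def funpow.simps comp_def by (rule flat_step_has_derivative)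
  from smooth_coordinate_affine[of F, OF this] show ?thesis by (simp add: F_def)
qed

lemma flat_step_1_bounds: "0 \<le> flat_step 1 t" "flat_step 1 t \<le> 1"
  by (auto simp: flat_step_def)

lemma flat_step_1_scaled_tendsto:
  "(\<lambda>N. flat_step 1 (real N * u)) \<longlonglongrightarrow> (if u > 0 then 1 else 0)"
proof (cases "u > 0")
  case True
  have "(\<lambda>N. exp (- (inverse (real N) * inverse u))) \<longlonglongrightarrow> exp (- (0 * inverse u))"
    by (intro tendsto_intros lim_inverse_n)
  then have "(\<lambda>N. flat_step 1 (real N * u)) \<longlonglongrightarrow> exp (- (0 * inverse u))"
    by (rule Lim_transform_eventually)
       (use eventually_gt_at_top[of "0 :: nat"] in eventually_elim, simp add: flat_step_def True)
  then show ?thesis using True by simp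
next
  case False
  then have "\<not> real N * u > 0" for N
    by (simp add: mult_nonneg_nonpos linorder_not_less)
  then have "(\<lambda>N. flat_step 1 (real N * u)) = (\<lambda>N. 0)"
    by (simp add: flat_step_def)
  then show ?thesis using False by simp
qed

text \<open>Test functions with values in [0, 1] that approximate the indicator of the open box: for
  a point inside, every factor has the form exp(-1/(N u)) with u > 0 and tends to 1 as N grows; for
  a point outside, some factor is 0.\<close>

definition box_bump :: "real ^ 'n \<Rightarrow> real ^ 'n \<Rightarrow> nat \<Rightarrow> real ^ 'n \<Rightarrow> real" where
  "box_bump a b N x = (\<Prod>i\<in>UNIV. flat_step 1 (real N * (x $ i - a $ i)) * flat_step 1 (real N * (b $ i - x $ i)))"

lemma box_bump_bounds: "0 \<le> box_bump a b N x" "box_bump a b N x \<le> 1"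
  unfolding box_bump_def
  by (auto intro!: prod_nonneg prod_le_1 mult_le_one mult_nonneg_nonneg simp: flat_step_1_bounds)

lemma box_bump_eq_0:
  assumes "x \<notin> box a b" shows "box_bump a b N x = 0"
proof -
  obtain i where "x $ i \<le> a $ i \<or> b $ i \<le> x $ i"
    using assms by (auto simp: mem_box_cart not_less)
  then have "flat_step 1 (real N * (x $ i - a $ i)) * flat_step 1 (real N * (b $ i - x $ i)) = 0"
    by (auto simp: flat_step_def zero_less_mult_iff)
  then show ?thesis
    unfolding box_bump_def by (intro prod_zero) auto
qed

lemma box_bump_tendsto: "(\<lambda>N. box_bump a b N x) \<longlonglongrightarrow> indicat_real (box a b) x"
proof -
  have "(\<lambda>N. box_bump a b N x) \<longlonglongrightarrow>
      (\<Prod>i\<in>UNIV. (if x $ i - a $ i > 0 then 1 else 0) * (if b $ i - x $ i > 0 then 1 else 0 :: real))"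
    unfolding box_bump_def by (intro tendsto_prod tendsto_mult flat_step_1_scaled_tendsto)
  also have "(\<Prod>i\<in>UNIV. (if x $ i - a $ i > 0 then 1 else 0) * (if b $ i - x $ i > 0 then 1 else 0 :: real))
      = indicat_real (box a b) x"
  proof (cases "x \<in> box a b")
    case True
    then show ?thesis by (simp add: mem_box_cart)
  next
    case False
    then obtain i where "\<not> (x $ i - a $ i > 0) \<or> \<not> (b $ i - x $ i > 0)"
      by (auto simp: mem_box_cart)
    then have "(\<Prod>i\<in>UNIV. (if x $ i - a $ i > 0 then 1 else 0) * (if b $ i - x $ i > 0 then 1 else 0 :: real)) = 0"
      by (intro prod_zero) auto
    then show ?thesis using False by simp
  qed
  finally show ?thesis .
qed

lemma test_function_box_bump: "test_function (box_bump a b N)"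
proof -
  have "smooth (\<lambda>x. flat_step 1 (real N * (x $ i - a $ i)) * flat_step 1 (real N * (b $ i - x $ i)))" for i
    using smooth_mult[OF smooth_flat_step[of 1 "real N" i "- real N * a $ i"]
        smooth_flat_step[of 1 "- real N" i "real N * b $ i"]]
    by (simp add: algebra_simps)
  then have "smooth (box_bump a b N)"
    unfolding box_bump_def[abs_def] by (intro smooth_prod) auto
  moreover have "{x. box_bump a b N x \<noteq> 0} \<subseteq> box a b"
    using box_bump_eq_0 by blast
  then have "bounded {x. box_bump a b N x \<noteq> 0}"
    by (rule bounded_subset[OF bounded_box])
  ultimately show ?thesis
    by (simp add: test_function_def)
qed

section \<open>Linear change of variables\<close>

text \<open>Integrating over the b0 coordinate first, with \<open>R z\<close> collecting the others,
  leaves g constant in the inner integral. There the shear is a translation of the line.\<close>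

lemma nn_integral_lborel_shear:
  fixes f :: "'a::euclidean_space \<Rightarrow> ennreal" and g :: "'a \<Rightarrow> real"
  assumes [measurable]: "f \<in> borel_measurable borel" "g \<in> borel_measurable borel"
    and b0: "b0 \<in> Basis" and g: "\<And>x t. g (t *\<^sub>R b0 + x) = g x"
  shows "(\<integral>\<^sup>+x. f (x + g x *\<^sub>R b0) \<partial>lborel) = (\<integral>\<^sup>+x. f x \<partial>lborel)"
proof -
  define I where "I = Basis - {b0}"
  have I: "finite I" "b0 \<notin> I" "insert b0 I = Basis"
    using b0 by (auto simp: I_def)
  define R where "R z = (\<Sum>b\<in>I. z b *\<^sub>R b)" for z :: "'a \<Rightarrow> real"
  interpret product_sigma_finite "\<lambda>_::'a. lborel :: real measure"
    by standard
  have iterate: "(\<integral>\<^sup>+x. h x \<partial>lborel) = (\<integral>\<^sup>+z. (\<integral>\<^sup>+t. h (t *\<^sub>R b0 + R z) \<partial>lborel) \<partial>Pi\<^sub>M I (\<lambda>_. lborel))"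
    if [measurable]: "h \<in> borel_measurable borel" for h :: "'a \<Rightarrow> ennreal"
  proof -
    have "(\<integral>\<^sup>+x. h x \<partial>lborel) = (\<integral>\<^sup>+z. h (\<Sum>b\<in>Basis. z b *\<^sub>R b) \<partial>Pi\<^sub>M Basis (\<lambda>_. lborel))"
      by (subst lborel_eq, subst nn_integral_distr) auto
    also have "\<dots> = (\<integral>\<^sup>+z. (\<integral>\<^sup>+t. h (\<Sum>b\<in>Basis. (z(b0 := t)) b *\<^sub>R b) \<partial>lborel) \<partial>Pi\<^sub>M I (\<lambda>_. lborel))"
      unfolding I(3)[symmetric] by (rule product_nn_integral_insert[OF I(1,2)]) measurable
    also have "\<dots> = (\<integral>\<^sup>+z. (\<integral>\<^sup>+t. h (t *\<^sub>R b0 + R z) \<partial>lborel) \<partial>Pi\<^sub>M I (\<lambda>_. lborel))"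
    proof -
      have "(\<Sum>b\<in>Basis. (z(b0 := t)) b *\<^sub>R b) = t *\<^sub>R b0 + R z" for z t
      proof -
        have "(\<Sum>b\<in>I. (z(b0 := t)) b *\<^sub>R b) = R z"
          unfolding R_def using I(2) by (intro sum.cong) auto
        then show ?thesis
          unfolding I(3)[symmetric] using I(1,2) by simp
      qed
      then show ?thesis by simp
    qed
    finally show ?thesis .
  qed
  have "(\<integral>\<^sup>+t. f (t *\<^sub>R b0 + R z + g (t *\<^sub>R b0 + R z) *\<^sub>R b0) \<partial>lborel) = (\<integral>\<^sup>+t. f (t *\<^sub>R b0 + R z) \<partial>lborel)" for z
  proof -
    have "(\<integral>\<^sup>+t. f (t *\<^sub>R b0 + R z) \<partial>lborel) = (\<integral>\<^sup>+t. f ((g (R z) + 1 * t) *\<^sub>R b0 + R z) \<partial>lborel)"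
      by (subst nn_integral_real_affine[where c = 1 and t = "g (R z)"]) auto
    then show ?thesis
      unfolding g by (simp add: algebra_simps)
  qed
  then show ?thesis
    by (simp add: iterate)
qed

lemma Basis_eq_range_axis: "(Basis :: (real ^ 'n) set) = range (\<lambda>i. axis i 1)"
  by (auto simp: Basis_vec_def)

lemma inj_axis: "inj (\<lambda>i. axis i 1 :: real ^ 'n)"
  by (simp add: inj_on_def axis_eq_axis)

text \<open>\<open>lborel\<close> is characterised by its values on boxes. The preimage of a box
  under a permutation of coordinates is the box with corners permuted by \<open>inv \<tau>\<close>,
  and the product of side lengths is the same.\<close>

lemma nn_integral_lborel_permute_coordinates:
  fixes f :: "real ^ 'n \<Rightarrow> ennreal" and \<tau> :: "'n \<Rightarrow> 'n"
  assumes [measurable]: "f \<in> borel_measurable borel" and \<tau>: "bij \<tau>"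
  shows "(\<integral>\<^sup>+x. f (\<chi> i. x $ \<tau> i) \<partial>lborel) = (\<integral>\<^sup>+x. f x \<partial>lborel)"
proof -
  let ?T = "\<lambda>x :: real ^ 'n. \<chi> i. x $ \<tau> i"
  have T: "?T \<in> borel_measurable borel"
    by (intro borel_measurable_continuous_onI continuous_intros)
  have Basis: "(\<Prod>b\<in>Basis. (u - l) \<bullet> b) = (\<Prod>i\<in>UNIV. u $ i - l $ i)" for u l :: "real ^ 'n"
    unfolding Basis_eq_range_axis prod.reindex[OF inj_axis] by (simp add: inner_axis)
  have "lborel = distr lborel borel ?T"
  proof (rule lborel_eqI)
    fix l u :: "real ^ 'n"
    assume le: "\<And>b. b \<in> Basis \<Longrightarrow> l \<bullet> b \<le> u \<bullet> b"
    let ?l = "\<chi> i. l $ inv \<tau> i" and ?u = "\<chi> i. u $ inv \<tau> i"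
    have lu: "l $ i \<le> u $ i" for i
      using le[of "axis i 1"] by (simp add: inner_axis)
    have pre: "?T -` box l u = box ?l ?u"
      by (auto simp: mem_box_cart) (metis \<tau> bij_inv_eq_iff)+
    have "emeasure (distr lborel borel ?T) (box l u) = emeasure lborel (box ?l ?u)"
      using T by (simp add: emeasure_distr pre)
    also have "\<dots> = (\<Prod>b\<in>Basis. (?u - ?l) \<bullet> b)"
      by (rule emeasure_lborel_box) (auto simp: Basis_vec_def inner_axis lu)
    also have "(\<Prod>b\<in>Basis. (?u - ?l) \<bullet> b) = (\<Prod>i\<in>UNIV. u $ inv \<tau> i - l $ inv \<tau> i)"
      unfolding Basis by simp
    also have "\<dots> = (\<Prod>i\<in>UNIV. u $ i - l $ i)"
      using prod.reindex_bij_betw[OF bij_imp_bij_inv[OF \<tau>], of "\<lambda>i. u $ i - l $ i"] by simp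
    finally show "emeasure (distr lborel borel ?T) (box l u) = (\<Prod>b\<in>Basis. (u - l) \<bullet> b)"
      unfolding Basis .
  qed simp
  then have "(\<integral>\<^sup>+x. f x \<partial>lborel) = (\<integral>\<^sup>+x. f x \<partial>distr lborel borel ?T)"
    by simp
  also have "\<dots> = (\<integral>\<^sup>+x. f (?T x) \<partial>lborel)"
    using T by (intro nn_integral_distr) auto
  finally show ?thesis by simp
qed

lemma nn_integral_lborel_stretch:
  fixes f :: "real ^ 'n \<Rightarrow> ennreal"
  assumes [measurable]: "f \<in> borel_measurable borel" and c: "\<And>i. c i \<noteq> 0"
  shows "(\<integral>\<^sup>+x. f x \<partial>lborel) = ennreal (\<Prod>i\<in>UNIV. \<bar>c i\<bar>) * (\<integral>\<^sup>+x. f (\<chi> i. c i * x $ i) \<partial>lborel)"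
proof -
  \<comment> \<open>\<open>lborel_affine_euclidean\<close> indexes its scaling factors by basis
    vectors; this linear functional takes the value \<open>c i\<close> on the i-th one.\<close>
  define d where "d b = (\<Sum>i\<in>UNIV. c i * b $ i)" for b :: "real ^ 'n"
  have d: "d (axis i 1) = c i" for i
    by (simp add: d_def axis_def if_distrib cong: if_cong)
  note Basis = Basis_eq_range_axis and inj = inj_axis
  have [measurable]: "(\<lambda>x :: real ^ 'n. \<chi> i. c i * x $ i) \<in> borel_measurable borel"
    by (intro borel_measurable_continuous_onI continuous_intros)
  have T: "0 + (\<Sum>j\<in>Basis. (d j * (x \<bullet> j)) *\<^sub>R j) = (\<chi> i. c i * x $ i)" for x :: "real ^ 'n"
    unfolding Basis sum.reindex[OF inj] comp_def d inner_axis
    by (simp add: vec_eq_iff axis_def if_distrib cong: if_cong)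
  have "lborel = density (distr lborel borel (\<lambda>x :: real ^ 'n. \<chi> i. c i * x $ i)) (\<lambda>_. \<Prod>j\<in>Basis. \<bar>d j\<bar>)"
    by (rule lborel_affine_euclidean[of d 0, unfolded T]) (auto simp: Basis d c)
  from arg_cong[OF this, of "\<lambda>M. integral\<^sup>N M f"]
  have "(\<integral>\<^sup>+x. f x \<partial>lborel) = (\<integral>\<^sup>+x. f x \<partial>density (distr lborel borel (\<lambda>x. \<chi> i. c i * x $ i)) (\<lambda>_. \<Prod>j\<in>Basis. \<bar>d j\<bar>))" .
  also have "\<dots> = (\<Prod>j\<in>Basis. \<bar>d j\<bar>) * (\<integral>\<^sup>+x. f (\<chi> i. c i * x $ i) \<partial>lborel)"
    by (subst nn_integral_density nn_integral_distr; simp add: nn_integral_cmult nn_integral_distr)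
  also have "(\<Prod>j\<in>Basis. \<bar>d j\<bar>) = (\<Prod>i\<in>UNIV. \<bar>c i\<bar>)"
    unfolding Basis prod.reindex[OF inj] by (simp add: d)
  finally show ?thesis .
qed

lemma matrix_vector_mult_borel_measurable [measurable]:
  fixes B :: "real ^ 'n ^ 'm"
  shows "(*v) B \<in> borel_measurable borel"
  by (intro borel_measurable_continuous_onI linear_continuous_on matrix_vector_mul_bounded_linear)

text \<open>The change of variables theorems of the library need a well-ordered index type.\<close>

lemma nn_integral_lborel_matrix:
  fixes f :: "real ^ 'n \<Rightarrow> ennreal" and B :: "real ^ 'n ^ 'n"
  assumes "f \<in> borel_measurable borel" "det B \<noteq> 0"
  shows "(\<integral>\<^sup>+x. f x \<partial>lborel) = ennreal \<bar>det B\<bar> * (\<integral>\<^sup>+x. f (B *v x) \<partial>lborel)"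
proof -
  define P where "P B \<longleftrightarrow> (det B \<noteq> 0 \<longrightarrow> (\<forall>f::real ^ 'n \<Rightarrow> ennreal. f \<in> borel_measurable borel \<longrightarrow>
    (\<integral>\<^sup>+x. f x \<partial>lborel) = ennreal \<bar>det B\<bar> * (\<integral>\<^sup>+x. f (B *v x) \<partial>lborel)))" for B :: "real ^ 'n ^ 'n"
  have "P B"
  \<comment> \<open>Matrices are generated under multiplication by those with a zero row, diagonal
    ones, coordinate swaps and unit shears. The premise \<open>det B \<noteq> 0\<close> inside P
    makes the first kind vacuous and passes from a product to both factors.\<close>
  proof (rule induct_matrix_elementary_alt[of P])
    fix A B assume P: "P A" "P B"
    show "P (A ** B)"
      unfolding P_def
    proof (intro impI allI)
      fix f :: "real ^ 'n \<Rightarrow> ennreal" assume d: "det (A ** B) \<noteq> 0" and [measurable]: "f \<in> borel_measurable borel"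
      from d have "det A \<noteq> 0" "det B \<noteq> 0" by (auto simp: det_mul)
      note P' = P(1)[unfolded P_def, rule_format, OF this(1)] P(2)[unfolded P_def, rule_format, OF this(2)]
      have "(\<integral>\<^sup>+x. f x \<partial>lborel) = ennreal \<bar>det A\<bar> * (\<integral>\<^sup>+x. f (A *v x) \<partial>lborel)"
        by (rule P'(1)) measurable
      also have "(\<integral>\<^sup>+x. f (A *v x) \<partial>lborel) = ennreal \<bar>det B\<bar> * (\<integral>\<^sup>+x. f (A *v (B *v x)) \<partial>lborel)"
        by (rule P'(2)) measurable
      finally show "(\<integral>\<^sup>+x. f x \<partial>lborel) = ennreal \<bar>det (A ** B)\<bar> * (\<integral>\<^sup>+x. f ((A ** B) *v x) \<partial>lborel)"
        by (simp add: det_mul abs_mult ennreal_mult mult.assoc matrix_vector_mul_assoc)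
    qed
  next
    fix A :: "real ^ 'n ^ 'n" and i assume "row i A = 0"
    then show "P A" by (simp add: P_def det_zero_row)
  next
    fix A :: "real ^ 'n ^ 'n" assume A: "\<And>i j. i \<noteq> j \<Longrightarrow> A $ i $ j = 0"
    have "A *v x = (\<chi> i. A $ i $ i * x $ i)" for x
    proof -
      have "(\<Sum>j\<in>UNIV. A $ i $ j * x $ j) = A $ i $ i * x $ i" for i
        by (subst sum.remove[of _ i]) (auto simp: A intro!: sum.neutral)
      then show ?thesis
        by (simp add: vec_eq_iff matrix_vector_mult_def)
    qed
    then show "P A"
      using nn_integral_lborel_stretch[of _ "\<lambda>i. A $ i $ i"] det_diagonal[OF A]
      by (simp add: P_def abs_prod)
  next
    fix m n :: 'n assume "m \<noteq> n"
    let ?\<tau> = "Transposition.transpose m n" and ?A = "\<chi> i j. mat 1 $ i $ Transposition.transpose m n j :: real ^ 'n ^ 'n"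
    have "?A *v x = (\<chi> i. x $ ?\<tau> i)" for x
    proof -
      have "(\<Sum>j\<in>UNIV. (if i = ?\<tau> j then 1 else 0) * x $ j) = x $ ?\<tau> i" for i
      proof -
        have "(\<Sum>j\<in>UNIV. (if i = ?\<tau> j then 1 else 0) * x $ j) = (\<Sum>j\<in>UNIV. if j = ?\<tau> i then x $ j else 0)"
          by (rule sum.cong) (auto simp: swap_id_eq)
        then show ?thesis by simp
      qed
      then show ?thesis
        by (simp add: matrix_vector_mult_def mat_def vec_eq_iff)
    qed
    moreover have "\<bar>det ?A\<bar> = 1"
      by (simp add: det_permute_columns permutes_swap_id sign_swap_id abs_mult)
    ultimately show "P ?A"
      by (simp add: P_def nn_integral_lborel_permute_coordinates)
  next
    fix m n :: 'n assume mn: "m \<noteq> n"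
    have axis_0: "axis m (1::real) $ n = 0"
      using mn by (simp add: axis_def)
    let ?A = "\<chi> i j. of_bool (i = m \<and> j = n \<or> i = j) :: real ^ 'n ^ 'n"
    have "?A *v x = x + x $ n *\<^sub>R axis m 1" for x
    proof -
      have "(\<Sum>j\<in>UNIV. of_bool (j = n \<or> m = j) * x $ j) = x $ m + x $ n"
      proof -
        have "(\<Sum>j\<in>UNIV. of_bool (j = n \<or> m = j) * x $ j) = (\<Sum>j\<in>{m, n}. x $ j)"
          by (rule sum.mono_neutral_cong_right) auto
        then show ?thesis using mn by simp
      qed
      then show ?thesis
        by (auto simp: vec_eq_iff matrix_vector_mult_def axis_def)
    qed
    moreover have "?A = (\<chi> k. if k = m then row m (mat 1) + 1 *s row n (mat 1) else row k (mat 1))"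
      using mn by (auto simp: vec_eq_iff row_def mat_def)
    then have "det ?A = 1"
      using det_row_operation[OF mn, of "mat 1" 1] by simp
    moreover have "(\<integral>\<^sup>+x. f (x + x $ n *\<^sub>R axis m 1) \<partial>lborel) = (\<integral>\<^sup>+x. f x \<partial>lborel)"
      if "f \<in> borel_measurable borel" for f :: "real ^ 'n \<Rightarrow> ennreal"
    proof (rule nn_integral_lborel_shear)
      show "(\<lambda>x :: real ^ 'n. x $ n) \<in> borel_measurable borel"
        by (intro borel_measurable_continuous_onI continuous_intros)
    qed (use that in \<open>auto simp: Basis_eq_range_axis axis_0\<close>)
    ultimately show "P ?A"
      by (simp add: P_def)
  qed
  then show ?thesis
    using assms unfolding P_def by blast
qed

section \<open>Iterated integrals for the completed measure\<close>

lemma AE_lebesgue_iff: "(AE x in lebesgue. P x) \<longleftrightarrow> (AE x in lborel. P x)"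
  by (rule AE_completion_iff)

lemmas AE_lborel_pair = lborel_pair.AE_pair[unfolded lborel_prod]

lemma borel_version:
  fixes f :: "'a::euclidean_space \<Rightarrow> real"
  assumes "f \<in> borel_measurable lebesgue"
  obtains g where "g \<in> borel_measurable borel" "AE x in lborel. f x = g x"
  using completion_ex_borel_measurable_real[OF assms] by auto

lemma AE_lborel_swap:
  fixes P :: "'a::euclidean_space \<times> 'b::euclidean_space \<Rightarrow> bool"
  assumes "AE p in lborel. P p"
  shows "AE p in lborel. P (prod.swap p)"
proof -
  obtain N where N: "N \<in> sets borel" "emeasure lborel N = 0" "{p. \<not> P p} \<subseteq> N"
    using assms unfolding eventually_ae_filter by (auto simp: null_sets_def)
  have swap: "prod.swap \<in> borel_measurable (borel :: ('b \<times> 'a) measure)"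
    by (intro borel_measurable_continuous_onI continuous_on_swap)
  have [measurable]: "N \<in> sets (lborel \<Otimes>\<^sub>M lborel)"
    unfolding lborel_prod using N(1) by simp
  have eqN: "(\<lambda>(x, y). (y, x)) -` N = prod.swap -` N"
    by auto
  have "emeasure lborel (prod.swap -` N) = emeasure (lborel \<Otimes>\<^sub>M lborel) (prod.swap -` N :: ('b \<times> 'a) set)"
    by (simp add: lborel_prod)
  also have "prod.swap -` N = (\<lambda>(x, y). (y, x)) -` N \<inter> space (lborel \<Otimes>\<^sub>M lborel :: ('b \<times> 'a) measure)"
    by (auto simp: space_pair_measure)
  also have "emeasure (lborel \<Otimes>\<^sub>M lborel) \<dots> = emeasure (distr (lborel \<Otimes>\<^sub>M lborel :: ('b \<times> 'a) measure) (lborel \<Otimes>\<^sub>M lborel) (\<lambda>(x, y). (y, x))) N"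
    by (rule emeasure_distr[symmetric]) measurable
  also have "\<dots> = emeasure (lborel \<Otimes>\<^sub>M lborel) N"
    by (subst lborel_pair.distr_pair_swap[symmetric]) simp
  finally have "emeasure lborel (prod.swap -` N) = 0"
    using N(2) eqN by (simp add: lborel_prod)
  moreover have "prod.swap -` N \<in> sets borel"
    using measurable_sets[OF swap N(1)] by simp
  ultimately show ?thesis
    using N(3) by (intro AE_I[of _ _ "prod.swap -` N"]) auto
qed

lemma AE_lebesgue_pair:
  fixes P :: "'a::euclidean_space \<times> 'b::euclidean_space \<Rightarrow> bool"
  assumes "AE p in lebesgue. P p"
  shows "AE y in lebesgue. AE x in lebesgue. P (y, x)"
    and "AE x in lebesgue. AE y in lebesgue. P (y, x)"
proof -
  have *: "AE y in lebesgue. AE x in lebesgue. Q (y, x)" if "AE p in lborel. Q p"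
    for Q :: "'c::euclidean_space \<times> 'd::euclidean_space \<Rightarrow> bool"
    using AE_lborel_pair[OF that] by (simp only: AE_lebesgue_iff)
  have P: "AE p in lborel. P p"
    using assms by (simp add: AE_lebesgue_iff)
  show "AE y in lebesgue. AE x in lebesgue. P (y, x)"
    by (rule *[OF P])
  show "AE x in lebesgue. AE y in lebesgue. P (y, x)"
    using *[OF AE_lborel_swap[OF P]] by simp
qed

text \<open>Tonelli holds for a Borel version G. For almost every y the sections of F and G agree
  almost everywhere, so the inner integrals coincide for almost every y.\<close>

lemma nn_integral_lebesgue_pair:
  fixes F :: "'a::euclidean_space \<times> 'b::euclidean_space \<Rightarrow> real"
  assumes "F \<in> borel_measurable lebesgue"
  shows "(\<integral>\<^sup>+p. ennreal \<bar>F p\<bar> \<partial>lebesgue) = (\<integral>\<^sup>+y. \<integral>\<^sup>+x. ennreal \<bar>F (y, x)\<bar> \<partial>lebesgue \<partial>lebesgue)"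
proof -
  obtain G where G: "G \<in> borel_measurable borel" "AE p in lborel. F p = G p"
    using assms by (rule borel_version)
  have [measurable]: "G \<in> borel_measurable (lborel \<Otimes>\<^sub>M lborel)"
    using G(1) by (simp add: lborel_prod)
  have ae: "AE y in lborel. AE x in lborel. F (y, x) = G (y, x)"
    by (rule AE_lborel_pair[OF G(2)])
  have "(\<integral>\<^sup>+p. ennreal \<bar>F p\<bar> \<partial>lebesgue) = (\<integral>\<^sup>+p. ennreal \<bar>G p\<bar> \<partial>(lborel \<Otimes>\<^sub>M lborel))"
    unfolding nn_integral_completion lborel_prod using G(2) by (intro nn_integral_cong_AE) auto
  also have "\<dots> = (\<integral>\<^sup>+y. \<integral>\<^sup>+x. ennreal \<bar>G (y, x)\<bar> \<partial>lborel \<partial>lborel)"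
    by (rule lborel.nn_integral_fst[symmetric]) measurable
  also have "\<dots> = (\<integral>\<^sup>+y. \<integral>\<^sup>+x. ennreal \<bar>F (y, x)\<bar> \<partial>lborel \<partial>lborel)"
    using ae by (intro nn_integral_cong_AE) (auto elim!: eventually_mono intro!: nn_integral_cong_AE)
  finally show ?thesis
    by (simp add: nn_integral_completion)
qed

text \<open>Null sections alone do not make a set null in the product; with joint measurability,
  Tonelli applied to the absolute value of F does. This is the step by which statements proved for
  each y separately become statements about pairs.\<close>

lemma AE_lebesgue_pairI:
  fixes F :: "'a::euclidean_space \<times> 'b::euclidean_space \<Rightarrow> real"
  assumes "F \<in> borel_measurable lebesgue" "AE y in lebesgue. AE x in lebesgue. F (y, x) = 0"
  shows "AE p in lebesgue. F p = 0"
proof -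
  have "(\<integral>\<^sup>+p. ennreal \<bar>F p\<bar> \<partial>lebesgue) = (\<integral>\<^sup>+(y::'a). \<integral>\<^sup>+(x::'b). 0 \<partial>lebesgue \<partial>lebesgue)"
    unfolding nn_integral_lebesgue_pair[OF assms(1)] using assms(2)
    by (intro nn_integral_cong_AE) (auto elim!: eventually_mono intro!: nn_integral_cong_AE simp del: nn_integral_const)
  then have "(\<integral>\<^sup>+p. ennreal \<bar>F p\<bar> \<partial>lebesgue) = 0"
    by simp
  moreover have "(\<lambda>p. ennreal \<bar>F p\<bar>) \<in> borel_measurable lebesgue"
    using assms(1) by measurable
  ultimately have "AE p in lebesgue. ennreal \<bar>F p\<bar> = 0"
    by (simp add: nn_integral_0_iff_AE)
  then show ?thesis by simp
qed

lemma integrable_lebesgue_borel_version: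
  fixes f g :: "'a::euclidean_space \<Rightarrow> real"
  assumes "g \<in> borel_measurable borel" "AE x in lborel. f x = g x"
  shows "integrable lebesgue f \<longleftrightarrow> integrable lborel g"
    and "integral\<^sup>L lebesgue f = integral\<^sup>L lborel g"
proof -
  have g: "g \<in> borel_measurable lebesgue"
    using assms(1) by (intro measurable_completion) simp
  have f: "f \<in> borel_measurable lebesgue"
    by (rule borel_measurable_AE[OF g]) (use assms(2) in \<open>auto simp: AE_lebesgue_iff\<close>)
  show "integrable lebesgue f \<longleftrightarrow> integrable lborel g"
    using integrable_cong_AE[OF f g] integrable_completion[of g lborel] assms
    by (simp add: AE_lebesgue_iff)
  show "integral\<^sup>L lebesgue f = integral\<^sup>L lborel g"
    using integral_cong_AE[OF f g] integral_completion[of g lborel] assms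
    by (simp add: AE_lebesgue_iff)
qed

lemma Fubini_lebesgue_fst:
  fixes F :: "'a::euclidean_space \<times> 'b::euclidean_space \<Rightarrow> real"
  assumes F: "integrable lebesgue F"
  shows "AE y in lebesgue. integrable lebesgue (\<lambda>x. F (y, x))"
    and "integrable lebesgue (\<lambda>y. LINT x|lebesgue. F (y, x))"
    and "(LINT y|lebesgue. LINT x|lebesgue. F (y, x)) = integral\<^sup>L lebesgue F"
proof -
  obtain G where G: "G \<in> borel_measurable borel" "AE p in lborel. F p = G p"
    using F by (blast intro: borel_version borel_measurable_integrable)
  have int: "integrable (lborel \<Otimes>\<^sub>M lborel) G"
    using F integrable_lebesgue_borel_version(1)[OF G] by (simp add: lborel_prod)
  have [measurable]: "G \<in> borel_measurable (lborel \<Otimes>\<^sub>M lborel)"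
    using G(1) by (simp add: lborel_prod)
  have sect: "(\<lambda>x. G (y, x)) \<in> borel_measurable borel" for y
  proof -
    have "(\<lambda>x. G (y, x)) \<in> borel_measurable lborel" by measurable
    then show ?thesis by simp
  qed
  have ae: "AE y in lborel. AE x in lborel. F (y, x) = G (y, x)"
    by (rule AE_lborel_pair[OF G(2)])
  have "AE y in lborel. integrable lborel (\<lambda>x. G (y, x))"
    by (rule lborel_pair.AE_integrable_fst'[OF int])
  with ae show "AE y in lebesgue. integrable lebesgue (\<lambda>x. F (y, x))"
    unfolding AE_lebesgue_iff
    by eventually_elim (rule integrable_lebesgue_borel_version(1)[OF sect, THEN iffD2])
  have ae': "AE y in lborel. (LINT x|lebesgue. F (y, x)) = (LINT x|lborel. G (y, x))"
    using ae by eventually_elim (rule integrable_lebesgue_borel_version(2)[OF sect])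
  have int': "integrable lborel (\<lambda>y. LINT x|lborel. G (y, x))"
    by (rule lborel_pair.integrable_fst'[OF int])
  then have "(\<lambda>y. LINT x|lborel. G (y, x)) \<in> borel_measurable borel"
    by (auto dest: borel_measurable_integrable)
  note version = integrable_lebesgue_borel_version[OF this ae']
  show "integrable lebesgue (\<lambda>y. LINT x|lebesgue. F (y, x))"
    using int' version(1) by simp
  show "(LINT y|lebesgue. LINT x|lebesgue. F (y, x)) = integral\<^sup>L lebesgue F"
    unfolding version(2) lborel_pair.integral_fst'[OF int]
    unfolding lborel_prod integrable_lebesgue_borel_version(2)[OF G] ..
qed

lemma integrable_lebesgue_swap:
  fixes F :: "'a::euclidean_space \<times> 'b::euclidean_space \<Rightarrow> real"
  assumes F: "integrable lebesgue F"
  shows "integrable lebesgue (\<lambda>p. F (prod.swap p))"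
    and "(LINT p|lebesgue. F (prod.swap p)) = integral\<^sup>L lebesgue F"
proof -
  obtain G where G: "G \<in> borel_measurable borel" "AE p in lborel. F p = G p"
    using F by (blast intro: borel_version borel_measurable_integrable)
  have int: "integrable (lborel \<Otimes>\<^sub>M lborel) G"
    using F integrable_lebesgue_borel_version(1)[OF G] by (simp add: lborel_prod)
  have swap: "prod.swap \<in> borel_measurable (borel :: ('b \<times> 'a) measure)"
    by (intro borel_measurable_continuous_onI continuous_on_swap)
  note version = integrable_lebesgue_borel_version[OF measurable_compose[OF swap G(1)] AE_lborel_swap[OF G(2)]]
  have eq: "(\<lambda>p. G (prod.swap p)) = (\<lambda>(x, y). G (y, x))"
    by auto
  show "integrable lebesgue (\<lambda>p. F (prod.swap p))"
    unfolding version(1) eq using lborel_pair.integrable_product_swap[OF int] by (simp add: lborel_prod)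
  show "(LINT p|lebesgue. F (prod.swap p)) = integral\<^sup>L lebesgue F"
    unfolding version(2) integrable_lebesgue_borel_version(2)[OF G] eq
    using lborel_pair.integral_product_swap[OF borel_measurable_integrable[OF int]] by (simp add: lborel_prod)
qed

lemma Fubini_lebesgue_snd:
  fixes F :: "'a::euclidean_space \<times> 'b::euclidean_space \<Rightarrow> real"
  assumes F: "integrable lebesgue F"
  shows "AE x in lebesgue. integrable lebesgue (\<lambda>y. F (y, x))"
    and "integrable lebesgue (\<lambda>x. LINT y|lebesgue. F (y, x))"
    and "(LINT x|lebesgue. LINT y|lebesgue. F (y, x)) = integral\<^sup>L lebesgue F"
  using Fubini_lebesgue_fst[OF integrable_lebesgue_swap(1)[OF F]] integrable_lebesgue_swap(2)[OF F]
  by simp_all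

lemma AE_lborel_fst:
  assumes "AE y in (lborel :: 'a::euclidean_space measure). P y"
  shows "AE p in (lborel :: ('a \<times> 'b::euclidean_space) measure). P (fst p)"
proof -
  obtain N where N: "N \<in> sets borel" "emeasure lborel N = 0" "{x. \<not> P x} \<subseteq> N"
    using assms unfolding eventually_ae_filter by (auto simp: null_sets_def)
  have "emeasure (lborel \<Otimes>\<^sub>M lborel) (N \<times> (UNIV :: 'b set)) = 0"
    using lborel.emeasure_pair_measure_Times[of N lborel UNIV] N by simp
  then show ?thesis
    using N by (intro AE_I[of _ _ "N \<times> UNIV"]) (auto simp: lborel_prod[symmetric])
qed

lemma borel_measurable_lebesgue_fst:
  fixes h :: "'a::euclidean_space \<Rightarrow> real"
  assumes "h \<in> borel_measurable lebesgue"
  shows "(\<lambda>p :: 'a \<times> 'b::euclidean_space. h (fst p)) \<in> borel_measurable lebesgue"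
proof -
  obtain g where g: "g \<in> borel_measurable borel" "AE x in lborel. h x = g x"
    using assms by (rule borel_version)
  have ae: "AE p in (lborel :: ('a \<times> 'b) measure). h (fst p) = g (fst p)"
    by (rule AE_lborel_fst[OF g(2)])
  have "(\<lambda>p :: 'a \<times> 'b. g (fst p)) \<in> borel_measurable (borel \<Otimes>\<^sub>M borel)"
    using g(1) by measurable
  then have "(\<lambda>p :: 'a \<times> 'b. g (fst p)) \<in> borel_measurable lborel"
    by (simp add: borel_prod)
  then show ?thesis
    by (intro borel_measurable_AE[OF measurable_completion])
       (use ae in \<open>auto simp: AE_lebesgue_iff\<close>)
qed

lemma borel_measurable_lebesgue_snd:
  fixes h :: "'b::euclidean_space \<Rightarrow> real"
  assumes "h \<in> borel_measurable borel"
  shows "(\<lambda>p :: 'a::euclidean_space \<times> 'b. h (snd p)) \<in> borel_measurable lebesgue"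
proof -
  have "(\<lambda>p :: 'a \<times> 'b. h (snd p)) \<in> borel_measurable (borel \<Otimes>\<^sub>M borel)"
    using assms by measurable
  then show ?thesis
    by (intro measurable_completion) (simp add: borel_prod)
qed

section \<open>Symbols\<close>

text \<open>Only words as long as L are ever evaluated, so hypotheses about derivatives can be
  restricted to a single order.\<close>

lemma word_sum_cong:
  "(\<And>w. length w = length L \<Longrightarrow> u w = v w) \<Longrightarrow> word_sum B L u = word_sum B L v"
proof (induction L arbitrary: u v)
  case (Cons j L)
  show ?case
    unfolding word_sum.simps by (intro sum.cong arg_cong2[of _ _ _ _ "(*)"] refl Cons.IH Cons.prems) simp
qed simp

lemma word_sum_scale: "word_sum B L (\<lambda>w. c * u w) = c * word_sum B L u"
  using word_sum_sum[of B L "\<lambda>_. c" "\<lambda>_. u" "{()}"] by simp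

lemma card_words: "card {w :: 'n::finite list. length w = m} = CARD('n) ^ m"
  using card_lists_length_eq[of "UNIV :: 'n set" m] by simp

lemma sum_words_Suc:
  "(\<Sum>w | length w = Suc m. h w) = (\<Sum>i\<in>UNIV. \<Sum>w | length w = m. h (i # w))"
  for h :: "'n::finite list \<Rightarrow> real"
proof -
  have "(\<Sum>i\<in>UNIV. \<Sum>w | length w = m. h (i # w)) = (\<Sum>(i, w)\<in>UNIV \<times> {w. length w = m}. h (i # w))"
    by (rule sum.cartesian_product)
  also have "\<dots> = (\<Sum>w | length w = Suc m. h w)"
    by (rule sum.reindex_bij_witness[of _ "\<lambda>w. (hd w, tl w)" "\<lambda>(i, w). i # w"])
       (auto simp: length_Suc_conv)
  finally show ?thesis ..
qed

text \<open>The coefficient of each word is a product of \<open>length L\<close> entries of B, and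
  every entry is bounded by the Frobenius norm.\<close>

lemma abs_word_sum_le:
  fixes B :: "real ^ 'n ^ 'n"
  shows "\<bar>word_sum B L u\<bar> \<le> norm B ^ length L * (\<Sum>w | length w = length L. \<bar>u w\<bar>)"
proof (induction L arbitrary: u)
  case Nil
  then show ?case by simp
next
  case (Cons j L)
  have "\<bar>word_sum B (j # L) u\<bar> \<le> (\<Sum>i\<in>UNIV. \<bar>B $ i $ j\<bar> * \<bar>word_sum B L (\<lambda>w. u (i # w))\<bar>)"
    unfolding word_sum.simps abs_mult[symmetric] by (rule sum_abs)
  also have "\<dots> \<le> (\<Sum>i\<in>UNIV. norm B * (norm B ^ length L * (\<Sum>w | length w = length L. \<bar>u (i # w)\<bar>)))"
  proof (intro sum_mono mult_mono Cons.IH)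
    fix i
    have "\<bar>B $ i $ j\<bar> \<le> norm (B $ i)" by (rule component_le_norm_cart)
    also have "\<dots> \<le> norm B" by (rule Finite_Cartesian_Product.norm_nth_le)
    finally show "\<bar>B $ i $ j\<bar> \<le> norm B" .
  qed auto
  also have "\<dots> = norm B ^ length (j # L) * (\<Sum>w | length w = length (j # L). \<bar>u w\<bar>)"
    by (simp add: sum_words_Suc sum_distrib_left mult.assoc)
  finally show ?case .
qed

text \<open>The linear functional on symbols that sends the monomial \<beta> to
  \<open>u \<beta>\<close>. It is \<open>apply_symbol\<close> with arbitrary numbers in place of
  derivatives at a point, which leaves u free to change in inductions.\<close>

definition symbol_eval :: "('a \<Rightarrow>\<^sub>0 real) \<Rightarrow> ('a \<Rightarrow> real) \<Rightarrow> real" where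
  "symbol_eval P u = (\<Sum>\<beta>\<in>Poly_Mapping.keys P. Poly_Mapping.lookup P \<beta> * u \<beta>)"

lemma symbol_eval_superset:
  assumes "finite S" "Poly_Mapping.keys P \<subseteq> S"
  shows "symbol_eval P u = (\<Sum>\<beta>\<in>S. Poly_Mapping.lookup P \<beta> * u \<beta>)"
  unfolding symbol_eval_def using assms
  by (intro sum.mono_neutral_left) (auto simp: in_keys_iff)

lemma symbol_eval_add: "symbol_eval (P + Q) u = symbol_eval P u + symbol_eval Q u"
proof -
  let ?S = "Poly_Mapping.keys P \<union> Poly_Mapping.keys Q"
  have "Poly_Mapping.keys (P + Q) \<subseteq> ?S" by (rule Poly_Mapping.keys_add)
  then show ?thesis
    by (simp add: symbol_eval_superset[of ?S] lookup_add distrib_right sum.distrib)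
qed

lemma symbol_eval_sum: "symbol_eval (\<Sum>i\<in>I. P i) u = (\<Sum>i\<in>I. symbol_eval (P i) u)"
proof (induction I rule: infinite_finite_induct)
  case (insert i I)
  then show ?case by (simp add: symbol_eval_add)
qed (simp_all add: symbol_eval_def)

lemma symbol_eval_single: "symbol_eval (Poly_Mapping.single k c) u = c * u k"
  by (simp add: symbol_eval_def)

lemma sum_single_lookup:
  "(\<Sum>\<beta>\<in>Poly_Mapping.keys P. Poly_Mapping.single \<beta> (Poly_Mapping.lookup P \<beta>)) = P"
  for P :: "'a \<Rightarrow>\<^sub>0 real"
proof (rule poly_mapping_eqI)
  fix k
  show "Poly_Mapping.lookup (\<Sum>\<beta>\<in>Poly_Mapping.keys P. Poly_Mapping.single \<beta> (Poly_Mapping.lookup P \<beta>)) k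
      = Poly_Mapping.lookup P k"
    by (auto simp: lookup_sum lookup_single when_def in_keys_iff)
qed

text \<open>Multiplying by a monomial shifts every exponent by k, which amounts to evaluating P on
  the shifted family.\<close>

lemma symbol_eval_single_mult:
  fixes P :: "'a::comm_monoid_add \<Rightarrow>\<^sub>0 real"
  shows "symbol_eval (Poly_Mapping.single k c * P) u = c * symbol_eval P (\<lambda>\<beta>. u (\<beta> + k))"
proof -
  have "symbol_eval (Poly_Mapping.single k c * P) u
      = symbol_eval (\<Sum>\<beta>\<in>Poly_Mapping.keys P. Poly_Mapping.single (k + \<beta>) (c * Poly_Mapping.lookup P \<beta>)) u"
    by (subst (1) sum_single_lookup[of P, symmetric]) (simp add: sum_distrib_left mult_single)
  then show ?thesis
    by (simp add: symbol_eval_sum symbol_eval_single sum_distrib_left symbol_eval_def[of P] mult.assoc add.commute)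
qed

lemma chain_symbol_word_index:
  "chain_symbol B (word_index L)
    = prod_list (map (\<lambda>j. \<Sum>i\<in>UNIV. Poly_Mapping.single (axis i 1) (B $ i $ j)) L)"
proof (induction L)
  case Nil
  then show ?case by (simp add: chain_symbol_def)
next
  case (Cons j L)
  let ?l = "\<lambda>j. \<Sum>i\<in>UNIV. Poly_Mapping.single (axis i 1) (B $ i $ j)"
  have "chain_symbol B (word_index (j # L)) = (\<Prod>k\<in>UNIV. ?l k ^ (word_index L $ k) * (if k = j then ?l k else 1))"
    unfolding chain_symbol_def by (intro prod.cong) (auto simp: word_index_def)
  also have "\<dots> = ?l j * chain_symbol B (word_index L)"
    unfolding prod.distrib chain_symbol_def by (simp add: mult.commute)
  finally show ?case using Cons by simp
qed

text \<open>Removing the head letter j of L removes one linear factor from the symbol. Each monomial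
  of that factor shifts u by \<open>axis i 1\<close>, exactly as prepending i to a word shifts its
  \<open>word_index\<close>. Thus the commutative expansion and the expansion over words agree
  although their summands are grouped differently.\<close>

lemma symbol_eval_chain_symbol:
  "symbol_eval (chain_symbol B (word_index L)) u = word_sum B L (\<lambda>w. u (word_index w))"
  unfolding chain_symbol_word_index
proof (induction L arbitrary: u)
  case Nil
  then show ?case by (simp add: symbol_eval_def)
next
  case (Cons j L)
  then show ?case
    by (simp add: sum_distrib_right symbol_eval_sum symbol_eval_single_mult word_index_Cons)
qed

lemma apply_symbol_chain_symbol:
  "apply_symbol (chain_symbol B (word_index L)) f x = word_sum B L (\<lambda>w. weak_D (word_index w) f x)"
  using symbol_eval_chain_symbol[of B L "\<lambda>\<beta>. weak_D \<beta> f x"]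
  by (simp add: apply_symbol_def symbol_eval_def)

section \<open>Uniqueness of weak derivatives\<close>

text \<open>Open boxes are stable under intersection and generate the Borel sets, and the sets over
  which h integrates to 0 form a Dynkin class. Closure under complements uses that the total
  integral is 0, which follows by exhausting the space with growing boxes.\<close>

lemma AE_zero_if_box_integrals_zero:
  fixes h :: "'a::euclidean_space \<Rightarrow> real"
  assumes h: "integrable lborel h" and box: "\<And>a b. (LINT x:box a b|lborel. h x) = 0"
  shows "AE x in lborel. h x = 0"
proof (rule sigma_finite_measure.density_zero[OF sigma_finite_lborel h])
  have set_int: "set_integrable lborel A h" if "A \<in> sets borel" for A
    unfolding set_integrable_def using h that by (intro integrable_mult_indicator) auto
  let ?Q = "\<lambda>n::nat. box (- (real n *\<^sub>R One)) (real n *\<^sub>R One) :: 'a set"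
  have "(\<lambda>n. LINT x:?Q n|lborel. h x) \<longlonglongrightarrow> (LINT x:(\<Union>n. ?Q n)|lborel. h x)"
  proof (rule set_integral_cont_up)
    show "incseq ?Q"
      by (auto simp: incseq_def box_def inner_simps intro: order_less_le_trans)
    show "set_integrable lborel (\<Union>n. ?Q n) h"
      by (rule set_int) simp
  qed simp
  then have total: "(LINT x:UNIV|lborel. h x) = 0"
    unfolding box UN_box_eq_UNIV using LIMSEQ_unique tendsto_const by blast
  fix A assume "A \<in> sets (lborel :: 'a measure)"
  then have "Int_stable (range (\<lambda>(a, b). box a b :: 'a set))" "range (\<lambda>(a, b). box a b :: 'a set) \<subseteq> Pow UNIV"
    "A \<in> sigma_sets UNIV (range (\<lambda>(a, b). box a b))"
    by (auto simp: borel_eq_box Int_stable_def box_Int_box)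
  then show "(LINT x:A|lborel. h x) = 0"
  proof (induction rule: sigma_sets_induct_disjoint)
    case (basic A)
    then show ?case using box by auto
  next
    case empty
    then show ?case by (simp add: set_lebesgue_integral_def)
  next
    case (compl A)
    then have A: "A \<in> sets borel" by (simp add: borel_eq_box)
    then have "(LINT x:A \<union> (UNIV - A)|lborel. h x) = (LINT x:A|lborel. h x) + (LINT x:UNIV - A|lborel. h x)"
      by (intro set_integral_Un set_int) auto
    then show ?case using total compl by simp
  next
    case (union A)
    then have A: "A i \<in> sets borel" for i by (auto simp: borel_eq_box)
    have "(LINT x:(\<Union>i. A i)|lborel. h x) = suminf (\<lambda>i. LINT x:A i|lborel. h x)"
      using union(1) A by (intro lebesgue_integral_countable_add set_int) (auto simp: disjoint_family_on_def)
    then show ?case using union(3) by simp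
  qed
qed

lemma integrable_mult_bounded:
  fixes u \<phi> :: "'a \<Rightarrow> real"
  assumes "integrable M u" "\<phi> \<in> borel_measurable M" "\<And>x. \<bar>\<phi> x\<bar> \<le> C"
  shows "integrable M (\<lambda>x. u x * \<phi> x)"
proof (rule Bochner_Integration.integrable_bound)
  show "integrable M (\<lambda>x. C * u x)"
    using assms(1) by simp
  show "(\<lambda>x. u x * \<phi> x) \<in> borel_measurable M"
    using assms(1,2) by measurable
  show "AE x in M. norm (u x * \<phi> x) \<le> norm (C * u x)"
  proof (rule AE_I2)
    fix x
    have "\<bar>u x\<bar> * \<bar>\<phi> x\<bar> \<le> \<bar>u x\<bar> * \<bar>C\<bar>"
      by (intro mult_left_mono) (use assms(3)[of x] in auto)
    then show "norm (u x * \<phi> x) \<le> norm (C * u x)"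
      by (simp add: abs_mult mult.commute)
  qed
qed

lemma integrable_imp_locally_integrable: "integrable lebesgue f \<Longrightarrow> locally_integrable f"
  unfolding locally_integrable_def set_integrable_def
  by (intro allI impI integrable_mult_indicator) (simp_all add: borel_compact)

lemma test_function_measurable_lebesgue:
  "test_function \<phi> \<Longrightarrow> \<phi> \<in> borel_measurable lebesgue"
  by (intro measurable_completion) (simp add: test_function_measurable)

lemma integrable_mult_test_function:
  assumes f: "locally_integrable f" and \<phi>: "test_function \<phi>"
  shows "integrable lebesgue (\<lambda>x. f x * \<phi> x)"
proof -
  define K where "K = closure {x. \<phi> x \<noteq> 0}"
  have "compact K"
    using \<phi> by (simp add: test_function_def K_def)
  then have u: "integrable lebesgue (\<lambda>x. indicator K x * f x)"
    using f by (simp add: locally_integrable_def set_integrable_def)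
  obtain C where C: "\<And>x. \<bar>\<phi> x\<bar> \<le> C"
    using test_function_bounded[OF \<phi>] by blast
  have "integrable lebesgue (\<lambda>x. indicator K x * f x * \<phi> x)"
    by (rule integrable_mult_bounded[OF u test_function_measurable_lebesgue[OF \<phi>] C])
  also have "(\<lambda>x. indicator K x * f x * \<phi> x) = (\<lambda>x. f x * \<phi> x)"
  proof
    fix x
    show "indicator K x * f x * \<phi> x = f x * \<phi> x"
    proof (cases "\<phi> x = 0")
      case False
      then have "x \<in> K" unfolding K_def by (intro subsetD[OF closure_subset]) simp
      then show ?thesis by simp
    qed simp
  qed
  finally show ?thesis .
qed

text \<open>Dominated convergence along \<open>box_bump\<close>. The majorant is the absolute value
  of h on the closed box, integrable because that box is compact and h is locally
  integrable.\<close>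

lemma box_integral_zero_if_test_integrals_zero:
  assumes h: "locally_integrable h"
    and zero: "\<And>\<phi>. test_function \<phi> \<Longrightarrow> (LINT x|lebesgue. h x * \<phi> x) = 0"
  shows "(LINT x|lebesgue. h x * indicator (box a b) x) = 0"
proof -
  let ?u = "\<lambda>x. indicator (cbox a b) x * h x"
  have u: "integrable lebesgue ?u"
    using h by (auto simp: locally_integrable_def set_integrable_def)
  have "(\<lambda>N. LINT x|lebesgue. ?u x * box_bump a b N x) \<longlonglongrightarrow> (LINT x|lebesgue. ?u x * indicator (box a b) x)"
  proof (rule integral_dominated_convergence[where w = "\<lambda>x. \<bar>?u x\<bar>"])
    show "(\<lambda>x. ?u x * indicator (box a b) x) \<in> borel_measurable lebesgue"
      using borel_measurable_integrable[OF u] by (rule borel_measurable_times[OF _ borel_measurable_indicator]) simp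
    show "(\<lambda>x. ?u x * box_bump a b N x) \<in> borel_measurable lebesgue" for N
      using borel_measurable_integrable[OF u] test_function_measurable_lebesgue[OF test_function_box_bump]
      by (rule borel_measurable_times)
    show "integrable lebesgue (\<lambda>x. \<bar>?u x\<bar>)"
      using u by (rule integrable_abs)
    show "AE x in lebesgue. (\<lambda>N. ?u x * box_bump a b N x) \<longlonglongrightarrow> ?u x * indicator (box a b) x"
      by (intro AE_I2 tendsto_mult tendsto_const box_bump_tendsto)
    show "AE x in lebesgue. norm (?u x * box_bump a b N x) \<le> \<bar>?u x\<bar>" for N
    proof (rule AE_I2)
      fix x
      have "\<bar>?u x\<bar> * \<bar>box_bump a b N x\<bar> \<le> \<bar>?u x\<bar> * 1"
        using box_bump_bounds[of a b N x] by (intro mult_left_mono) auto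
      then show "norm (?u x * box_bump a b N x) \<le> \<bar>?u x\<bar>"
        by (simp add: abs_mult)
    qed
  qed
  moreover have "?u x * box_bump a b N x = h x * box_bump a b N x" for x N
    using box_bump_eq_0[of x a b N] box_subset_cbox[of a b] by (cases "x \<in> box a b") auto
  moreover have "?u x * indicator (box a b) x = h x * indicator (box a b) x" for x
    using box_subset_cbox[of a b] by (cases "x \<in> box a b") auto
  moreover have "(LINT x|lebesgue. h x * box_bump a b N x) = 0" for N
    by (rule zero[OF test_function_box_bump])
  ultimately show ?thesis
    by (simp add: LIMSEQ_const_iff)
qed

text \<open>The fundamental lemma of the calculus of variations. Cutting h off to a box makes it
  integrable; since two boxes meet in a box, the cut-off function has vanishing integral over every
  box. Countably many growing boxes then cover the space.\<close>

lemma AE_zero_if_test_integrals_zero: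
  fixes h :: "real ^ 'n \<Rightarrow> real"
  assumes h: "locally_integrable h"
    and zero: "\<And>\<phi>. test_function \<phi> \<Longrightarrow> (LINT x|lebesgue. h x * \<phi> x) = 0"
  shows "AE x in lebesgue. h x = 0"
proof -
  let ?Q = "\<lambda>n::nat. box (- (real n *\<^sub>R One)) (real n *\<^sub>R One) :: (real ^ 'n) set"
  have "AE x in lebesgue. h x * indicator (?Q n) x = 0" for n
  proof -
    define a b where "a = - (real n *\<^sub>R One :: real ^ 'n)" and "b = (real n *\<^sub>R One :: real ^ 'n)"
    define u where "u x = h x * indicator (box a b) x" for x
    have "integrable lebesgue (\<lambda>x. indicator (cbox a b) x * h x * indicator (box a b) x)"
      using h by (intro integrable_real_mult_indicator) (auto simp: locally_integrable_def set_integrable_def)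
    moreover have "indicator (cbox a b) x * h x * indicator (box a b) x = u x" for x
      using box_subset_cbox[of a b] unfolding u_def by (cases "x \<in> box a b") auto
    ultimately have u: "integrable lebesgue u"
      by simp
    then obtain g where g: "g \<in> borel_measurable borel" "AE x in lborel. u x = g x"
      using borel_version[OF borel_measurable_integrable] by blast
    have "AE x in lborel. g x = 0"
    proof (rule AE_zero_if_box_integrals_zero)
      show "integrable lborel g"
        using integrable_lebesgue_borel_version(1)[OF g] u by simp
      fix c d :: "real ^ 'n"
      obtain c' d' where cd: "box c d \<inter> box a b = box c' d'"
        by (simp add: box_Int_box)
      have "(LINT x:box c d|lborel. g x) = (LINT x|lebesgue. indicator (box c d) x * u x)"
        unfolding set_lebesgue_integral_def real_scaleR_def
      proof (rule integrable_lebesgue_borel_version(2)[symmetric])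
        show "(\<lambda>x. indicat_real (box c d) x * g x) \<in> borel_measurable borel"
          using g(1) by measurable
      qed (use g(2) in auto)
      also have "(\<lambda>x. indicator (box c d) x * u x) = (\<lambda>x. h x * indicator (box c' d') x)"
        unfolding u_def cd[symmetric] by (auto simp: indicator_def)
      also have "(LINT x|lebesgue. h x * indicator (box c' d') x) = 0"
        by (rule box_integral_zero_if_test_integrals_zero[OF h zero])
      finally show "(LINT x:box c d|lborel. g x) = 0" .
    qed
    with g(2) have "AE x in lborel. u x = 0"
      by eventually_elim simp
    then show ?thesis
      by (simp add: AE_lebesgue_iff u_def[abs_def] a_def b_def)
  qed
  then have "AE x in lebesgue. \<forall>n. h x * indicator (?Q n) x = 0"
    unfolding AE_all_countable by blast
  then show ?thesis
  proof eventually_elim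
    fix x assume *: "\<forall>n. h x * indicator (?Q n) x = 0"
    have "x \<in> (\<Union>n. ?Q n)"
      unfolding UN_box_eq_UNIV by simp
    then obtain n where "x \<in> ?Q n" by blast
    then show "h x = 0" using spec[OF *, of n] by simp
  qed
qed

lemma has_weak_deriv_unique:
  assumes "has_weak_deriv \<alpha> f g" "has_weak_deriv \<alpha> f g'"
  shows "AE x in lebesgue. g x = g' x"
proof -
  have loc: "locally_integrable g" "locally_integrable g'"
    using assms by (auto simp: has_weak_deriv_def)
  have "AE x in lebesgue. g x - g' x = 0"
  proof (rule AE_zero_if_test_integrals_zero)
    show "locally_integrable (\<lambda>x. g x - g' x)"
      using loc by (auto simp: locally_integrable_def set_integral_diff)
    fix \<phi> :: "real ^ 'a \<Rightarrow> real" assume \<phi>: "test_function \<phi>"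
    have "(- 1) ^ mi_order \<alpha> * (LINT x|lebesgue. g x * \<phi> x) = (- 1) ^ mi_order \<alpha> * (LINT x|lebesgue. g' x * \<phi> x)"
      using assms \<phi> unfolding has_weak_deriv_def by metis
    then show "(LINT x|lebesgue. (g x - g' x) * \<phi> x) = 0"
      using integrable_mult_test_function[OF loc(1) \<phi>] integrable_mult_test_function[OF loc(2) \<phi>]
      by (simp add: left_diff_distrib)
  qed
  then show ?thesis by simp
qed

section \<open>Measurability of dilations\<close>

text \<open>The substitution rule as an identity of measures, so that it transfers integrability and
  signed integrals in addition to nonnegative ones.\<close>

lemma lborel_eq_density_matrix:
  fixes B :: "real ^ 'n ^ 'n"
  assumes "det B \<noteq> 0"
  shows "lborel = density (distr lborel borel ((*v) B)) (\<lambda>_. ennreal \<bar>det B\<bar>)"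
proof (rule measure_eqI)
  fix X assume "X \<in> sets (lborel :: (real ^ 'n) measure)"
  then have [measurable]: "X \<in> sets borel" by simp
  have "emeasure lborel X = (\<integral>\<^sup>+x. indicator X x \<partial>lborel)"
    by simp
  also have "\<dots> = ennreal \<bar>det B\<bar> * (\<integral>\<^sup>+x. indicator X (B *v x) \<partial>lborel)"
    by (rule nn_integral_lborel_matrix[OF _ assms]) measurable
  also have "\<dots> = emeasure (density (distr lborel borel ((*v) B)) (\<lambda>_. ennreal \<bar>det B\<bar>)) X"
    by (simp add: emeasure_density nn_integral_cmult nn_integral_distr del: nn_integral_indicator)
  finally show "emeasure lborel X = emeasure (density (distr lborel borel ((*v) B)) (\<lambda>_. ennreal \<bar>det B\<bar>)) X" .
qed simp

text \<open>Substitution in the integral of the indicator of a null set. As a consequence, changing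
  f on a null set changes f(Bx) only on a null set.\<close>

lemma AE_lborel_matrix:
  fixes B :: "real ^ 'n ^ 'n"
  assumes B: "det B \<noteq> 0" and P: "AE x in lborel. P x"
  shows "AE x in lborel. P (B *v x)"
proof -
  obtain N where N: "N \<in> sets borel" "emeasure lborel N = 0" "{x. \<not> P x} \<subseteq> N"
    using P unfolding eventually_ae_filter by (auto simp: null_sets_def)
  have [measurable]: "N \<in> sets borel" by fact
  have "0 = (\<integral>\<^sup>+x. indicator N x \<partial>lborel)"
    using N by simp
  also have "\<dots> = ennreal \<bar>det B\<bar> * (\<integral>\<^sup>+x. indicator N (B *v x) \<partial>lborel)"
    by (rule nn_integral_lborel_matrix[OF _ B]) measurable
  finally have "(\<integral>\<^sup>+x. indicator N (B *v x) \<partial>lborel) = 0"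
    using B by simp
  moreover have "(\<lambda>x. indicator N (B *v x) :: ennreal) \<in> borel_measurable lborel"
    by measurable
  ultimately have "AE x in lborel. indicator N (B *v x) = (0 :: ennreal)"
    by (subst (asm) nn_integral_0_iff_AE) auto
  then show ?thesis
    by eventually_elim (use N(3) in \<open>auto simp: indicator_def split: if_splits\<close>)
qed

lemma
  fixes f :: "real ^ 'n \<Rightarrow> real" and B :: "real ^ 'n ^ 'n"
  assumes f: "f \<in> borel_measurable lebesgue" and B: "det B \<noteq> 0"
  shows borel_measurable_lebesgue_matrix: "(\<lambda>x. f (B *v x)) \<in> borel_measurable lebesgue"
    and nn_integral_lebesgue_matrix:
      "(\<integral>\<^sup>+x. ennreal \<bar>f (B *v x)\<bar> \<partial>lebesgue) = ennreal (inverse \<bar>det B\<bar>) * (\<integral>\<^sup>+x. ennreal \<bar>f x\<bar> \<partial>lebesgue)"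
    and integrable_lebesgue_matrix: "integrable lebesgue f \<Longrightarrow> integrable lebesgue (\<lambda>x. f (B *v x))"
    and integral_lebesgue_matrix: "(LINT x|lebesgue. f x) = \<bar>det B\<bar> * (LINT x|lebesgue. f (B *v x))"
proof -
  obtain g where g: "g \<in> borel_measurable borel" "AE x in lborel. f x = g x"
    using f by (rule borel_version)
  have [measurable]: "g \<in> borel_measurable borel" by fact
  have gB: "(\<lambda>x. g (B *v x)) \<in> borel_measurable borel" by measurable
  have ae: "AE x in lborel. f (B *v x) = g (B *v x)"
    by (rule AE_lborel_matrix[OF B g(2)])
  show "(\<lambda>x. f (B *v x)) \<in> borel_measurable lebesgue"
  proof (rule borel_measurable_AE)
    show "(\<lambda>x. g (B *v x)) \<in> borel_measurable lebesgue"
      by (rule measurable_completion) (simp add: gB)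
    show "AE x in lebesgue. g (B *v x) = f (B *v x)"
      unfolding AE_lebesgue_iff using ae by eventually_elim simp
  qed
  have "(\<integral>\<^sup>+x. ennreal \<bar>f x\<bar> \<partial>lebesgue) = (\<integral>\<^sup>+x. ennreal \<bar>g x\<bar> \<partial>lborel)"
    unfolding nn_integral_completion using g(2) by (intro nn_integral_cong_AE) auto
  also have "\<dots> = ennreal \<bar>det B\<bar> * (\<integral>\<^sup>+x. ennreal \<bar>g (B *v x)\<bar> \<partial>lborel)"
    by (rule nn_integral_lborel_matrix[OF _ B]) measurable
  also have "(\<integral>\<^sup>+x. ennreal \<bar>g (B *v x)\<bar> \<partial>lborel) = (\<integral>\<^sup>+x. ennreal \<bar>f (B *v x)\<bar> \<partial>lebesgue)"
    unfolding nn_integral_completion using ae by (intro nn_integral_cong_AE) auto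
  finally have eq: "(\<integral>\<^sup>+x. ennreal \<bar>f x\<bar> \<partial>lebesgue) = ennreal \<bar>det B\<bar> * (\<integral>\<^sup>+x. ennreal \<bar>f (B *v x)\<bar> \<partial>lebesgue)" .
  have "ennreal (inverse \<bar>det B\<bar>) * ennreal \<bar>det B\<bar> = 1"
    using B by (simp add: ennreal_mult[symmetric])
  then show "(\<integral>\<^sup>+x. ennreal \<bar>f (B *v x)\<bar> \<partial>lebesgue) = ennreal (inverse \<bar>det B\<bar>) * (\<integral>\<^sup>+x. ennreal \<bar>f x\<bar> \<partial>lebesgue)"
    unfolding eq mult.assoc[symmetric] by simp
  let ?D = "distr lborel borel ((*v) B)"
  note D = lborel_eq_density_matrix[OF B]
  have "integrable lborel g \<longleftrightarrow> integrable (density ?D (\<lambda>_. ennreal \<bar>det B\<bar>)) g"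
    using arg_cong[OF D, of "\<lambda>M. integrable M g"] .
  also have "\<dots> \<longleftrightarrow> integrable ?D (\<lambda>x. \<bar>det B\<bar> *\<^sub>R g x)"
    by (rule integrable_density) auto
  also have "\<dots> \<longleftrightarrow> integrable ?D g"
    using B by simp
  also have "\<dots> \<longleftrightarrow> integrable lborel (\<lambda>x. g (B *v x))"
    by (rule integrable_distr_eq) measurable
  finally have lborel_integrable: "integrable lborel g \<longleftrightarrow> integrable lborel (\<lambda>x. g (B *v x))" .
  have "integral\<^sup>L lborel g = integral\<^sup>L (density ?D (\<lambda>_. ennreal \<bar>det B\<bar>)) g"
    using arg_cong[OF D, of "\<lambda>M. integral\<^sup>L M g"] .
  also have "\<dots> = (LINT x|?D. \<bar>det B\<bar> *\<^sub>R g x)"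
    by (rule integral_density) auto
  also have "\<dots> = \<bar>det B\<bar> * (LINT x|?D. g x)"
    by simp
  also have "(LINT x|?D. g x) = (LINT x|lborel. g (B *v x))"
    by (rule integral_distr) measurable
  finally have lborel_integral: "integral\<^sup>L lborel g = \<bar>det B\<bar> * (LINT x|lborel. g (B *v x))" .
  show "integrable lebesgue f \<Longrightarrow> integrable lebesgue (\<lambda>x. f (B *v x))"
    unfolding integrable_lebesgue_borel_version(1)[OF g] integrable_lebesgue_borel_version(1)[OF gB ae] lborel_integrable .
  show "(LINT x|lebesgue. f x) = \<bar>det B\<bar> * (LINT x|lebesgue. f (B *v x))"
    unfolding integrable_lebesgue_borel_version(2)[OF g] integrable_lebesgue_borel_version(2)[OF gB ae] lborel_integral ..
qed

section \<open>Joint measurability of dilations with variable matrix\<close>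

lemma borel_measurable_matrix_entry:
  fixes A :: "'a \<Rightarrow> real ^ 'n ^ 'm"
  assumes "A \<in> borel_measurable M"
  shows "(\<lambda>y. A y $ i $ j) \<in> borel_measurable M"
proof -
  have "(\<lambda>B :: real ^ 'n ^ 'm. B $ i $ j) \<in> borel_measurable borel"
    by (intro borel_measurable_continuous_onI continuous_intros)
  from measurable_compose[OF assms this] show ?thesis .
qed

lemma borel_measurable_det:
  fixes A :: "'a \<Rightarrow> real ^ 'n ^ 'n"
  assumes "A \<in> borel_measurable M"
  shows "(\<lambda>y. det (A y)) \<in> borel_measurable M"
  unfolding det_def
  by (intro borel_measurable_sum borel_measurable_times borel_measurable_prod borel_measurable_const
      borel_measurable_matrix_entry[OF assms])

lemma borel_measurable_matrixI:
  fixes A :: "'a \<Rightarrow> real ^ 'n ^ 'm"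
  assumes "\<And>i j. (\<lambda>y. A y $ i $ j) \<in> borel_measurable M"
  shows "A \<in> borel_measurable M"
  using assms by (subst borel_measurable_euclidean_space) (auto simp: Basis_vec_def inner_axis)

lemma borel_version_matrix:
  fixes A :: "'a::euclidean_space \<Rightarrow> real ^ 'n ^ 'm"
  assumes "A \<in> borel_measurable lebesgue"
  obtains A' where "A' \<in> borel_measurable borel" "AE x in lborel. A x = A' x"
proof -
  have "\<forall>i j. \<exists>g. g \<in> borel_measurable borel \<and> (AE x in lborel. A x $ i $ j = g x)"
    using borel_version[OF borel_measurable_matrix_entry[OF assms]] by metis
  then obtain g where g: "\<And>i j. g i j \<in> borel_measurable borel" "\<And>i j. AE x in lborel. A x $ i $ j = g i j x"
    by metis
  show thesis
  proof
    show "(\<lambda>x. \<chi> i j. g i j x) \<in> borel_measurable borel"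
      using g(1) by (intro borel_measurable_matrixI) simp
    have "AE x in lborel. \<forall>i j. A x $ i $ j = g i j x"
      using g(2) unfolding AE_all_countable by blast
    then show "AE x in lborel. A x = (\<chi> i j. g i j x)"
      by eventually_elim (simp add: vec_eq_iff)
  qed
qed

text \<open>A Lebesgue measurable f need not compose measurably with a Borel map. With f equal to a
  Borel g off a Borel null set N, and A replaced by a Borel, everywhere invertible
  \<open>A'\<close>, the pairs with \<open>A' y *v x\<close> in N form a measurable set with null
  sections, hence a null set. Where \<Phi> vanishes, so does the product.\<close>

lemma borel_measurable_dilation:
  fixes f :: "real ^ 'n \<Rightarrow> real" and A :: "'a::euclidean_space \<Rightarrow> real ^ 'n ^ 'n"
  assumes f: "f \<in> borel_measurable lebesgue" and A: "A \<in> borel_measurable lebesgue"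
    and \<Phi>: "\<Phi> \<in> borel_measurable lebesgue" and inv: "AE y in lebesgue. \<Phi> y \<noteq> 0 \<longrightarrow> det (A y) \<noteq> 0"
  shows "(\<lambda>p. \<Phi> (fst p) * f (A (fst p) *v snd p)) \<in> borel_measurable lebesgue"
proof -
  obtain g where g: "g \<in> borel_measurable borel" "AE x in lborel. f x = g x"
    using f by (rule borel_version)
  have [measurable]: "g \<in> borel_measurable borel" by fact
  obtain N where N: "N \<in> sets borel" "emeasure lborel N = 0" "{x. f x \<noteq> g x} \<subseteq> N"
    using g(2) unfolding eventually_ae_filter by (auto simp: null_sets_def)
  have [measurable]: "N \<in> sets borel" by fact
  obtain A1 where A1: "A1 \<in> borel_measurable borel" "AE y in lborel. A y = A1 y"
    using A by (rule borel_version_matrix)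
  \<comment> \<open>The identity is an arbitrary invertible default. By the hypothesis on
    determinants it replaces A, up to a null set, only where \<Phi> is 0.\<close>
  define A' where "A' y = (if det (A1 y) = 0 then mat 1 else A1 y)" for y
  have A'_meas: "A' \<in> borel_measurable borel"
    unfolding A'_def using A1(1) borel_measurable_det[OF A1(1)] by measurable
  have A'_det: "det (A' y) \<noteq> 0" for y
    by (simp add: A'_def)
  have entry [measurable]: "(\<lambda>y. A' y $ i $ j) \<in> borel_measurable borel" for i j
    by (rule borel_measurable_matrix_entry[OF A'_meas])
  have T: "(\<lambda>p. A' (fst p) *v snd p) \<in> borel \<Otimes>\<^sub>M borel \<rightarrow>\<^sub>M borel"
  proof (subst borel_measurable_euclidean_space, rule)
    fix b :: "real ^ 'n" assume "b \<in> Basis"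
    then obtain i where b: "b = axis i 1" by (auto simp: Basis_eq_range_axis)
    have [measurable]: "(\<lambda>x :: real ^ 'n. x $ j) \<in> borel_measurable borel" for j
      by (intro borel_measurable_continuous_onI continuous_intros)
    show "(\<lambda>p. (A' (fst p) *v snd p) \<bullet> b) \<in> borel_measurable (borel \<Otimes>\<^sub>M borel)"
      unfolding b inner_axis matrix_vector_mult_def by simp measurable
  qed
  have [measurable]: "(\<lambda>p. A' (fst p) *v snd p) \<in> borel_measurable lborel"
    using T by (simp add: borel_prod)
  have gT: "(\<lambda>p. g (A' (fst p) *v snd p)) \<in> borel_measurable lebesgue"
    by (intro measurable_completion) measurable
  have "AE p in lebesgue. indicat_real N (A' (fst p) *v snd p) = 0"
  proof (rule AE_lebesgue_pairI)
    show "(\<lambda>p. indicat_real N (A' (fst p) *v snd p)) \<in> borel_measurable lebesgue"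
      by (intro measurable_completion) measurable
    have "AE x in lborel. x \<notin> N"
      using N by (intro AE_not_in) (auto simp: null_sets_def)
    from AE_lborel_matrix[OF A'_det this]
    show "AE y in lebesgue. AE x in lebesgue. indicat_real N (A' (fst (y, x)) *v snd (y, x)) = 0"
      unfolding AE_lebesgue_iff by (simp add: indicator_eq_0_iff)
  qed
  moreover have "AE p in (lborel :: ('a \<times> (real ^ 'n)) measure). \<Phi> (fst p) \<noteq> 0 \<longrightarrow> A (fst p) = A' (fst p)"
  proof (rule AE_lborel_fst)
    show "AE y in lborel. \<Phi> y \<noteq> 0 \<longrightarrow> A y = A' y"
      using inv[unfolded AE_lebesgue_iff] A1(2) by eventually_elim (auto simp: A'_def)
  qed
  ultimately have "AE p in lborel. \<Phi> (fst p) * g (A' (fst p) *v snd p) = \<Phi> (fst p) * f (A (fst p) *v snd p)"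
    unfolding AE_lebesgue_iff
  proof eventually_elim
    case (elim p)
    have "f (A' (fst p) *v snd p) = g (A' (fst p) *v snd p)"
      using elim(1) N(3) unfolding indicator_eq_0_iff by blast
    with elim(2) show ?case by (cases "\<Phi> (fst p) = 0") simp_all
  qed
  moreover have "(\<lambda>p. \<Phi> (fst p) * g (A' (fst p) *v snd p)) \<in> borel_measurable lebesgue"
    by (intro borel_measurable_times borel_measurable_lebesgue_fst \<Phi> gT)
  ultimately show ?thesis
    unfolding AE_lebesgue_iff[symmetric] by (rule borel_measurable_AE[rotated])
qed

text \<open>The factor \<Phi> is distributed into every summand of the recursion, since joint
  measurability of a dilation is known only after multiplication by \<Phi>, which hides the singular
  matrices.\<close>

lemma borel_measurable_word_sum_dilation:
  fixes g :: "'n list \<Rightarrow> real ^ 'n \<Rightarrow> real" and A :: "'a::euclidean_space \<Rightarrow> real ^ 'n ^ 'n"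
  assumes A: "A \<in> borel_measurable lebesgue"
    and \<Phi>: "\<Phi> \<in> borel_measurable lebesgue" and inv: "AE y in lebesgue. \<Phi> y \<noteq> 0 \<longrightarrow> det (A y) \<noteq> 0"
    and g: "\<And>w. length w = length L \<Longrightarrow> g w \<in> borel_measurable lebesgue"
  shows "(\<lambda>p. \<Phi> (fst p) * word_sum (A (fst p)) L (\<lambda>w. g w (A (fst p) *v snd p))) \<in> borel_measurable lebesgue"
  using g
proof (induction L arbitrary: g)
  case Nil
  then show ?case
    using borel_measurable_dilation[OF _ A \<Phi> inv] by simp
next
  case (Cons j L)
  have "(\<lambda>p. \<Sum>i\<in>UNIV. A (fst p) $ i $ j * (\<Phi> (fst p) * word_sum (A (fst p)) L (\<lambda>w. g (i # w) (A (fst p) *v snd p))))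
      \<in> borel_measurable lebesgue"
    by (intro borel_measurable_sum borel_measurable_times Cons.IH Cons.prems
        borel_measurable_lebesgue_fst[of "\<lambda>y. A y $ i $ j" for i] borel_measurable_matrix_entry[OF A]) simp
  then show ?case
    by (simp add: sum_distrib_left mult.left_commute)
qed

section \<open>Chain rule and the integral kernel\<close>

lemma
  fixes u :: "'n::finite list \<Rightarrow> 'a \<Rightarrow> real"
  assumes "\<And>w. length w = length L \<Longrightarrow> integrable M (u w)"
  shows integrable_word_sum: "integrable M (\<lambda>x. word_sum B L (\<lambda>w. u w x))"
    and integral_word_sum: "(LINT x|M. word_sum B L (\<lambda>w. u w x)) = word_sum B L (\<lambda>w. LINT x|M. u w x)"
proof -
  have "integrable M (\<lambda>x. word_sum B L (\<lambda>w. u w x)) \<and>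
      (LINT x|M. word_sum B L (\<lambda>w. u w x)) = word_sum B L (\<lambda>w. LINT x|M. u w x)"
    using assms
  proof (induction L arbitrary: u)
    case (Cons j L)
    have "integrable M (u (i # w))" if "length w = length L" for i w
      using Cons.prems that by simp
    note IH = Cons.IH[of "\<lambda>w. u (i # w)" for i, OF this]
    from IH show ?case by simp
  qed simp
  then show "integrable M (\<lambda>x. word_sum B L (\<lambda>w. u w x))"
    "(LINT x|M. word_sum B L (\<lambda>w. u w x)) = word_sum B L (\<lambda>w. LINT x|M. u w x)" by auto
qed

text \<open>Writing \<phi> as \<psi> composed with B expands its derivative into derivatives of
  \<psi> at Bx with coefficients from B. After substitution each word can be integrated by parts
  against f separately, and linearity of \<open>word_sum\<close> reassembles the same coefficients
  around the weak derivatives of f.\<close>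

lemma has_weak_deriv_compose_matrix:
  fixes B :: "real ^ 'n ^ 'n"
  assumes f: "integrable lebesgue f" and B: "det B \<noteq> 0"
    and g: "\<And>w. length w = length L \<Longrightarrow> has_weak_deriv (word_index w) f (g w)"
    and g_int: "\<And>w. length w = length L \<Longrightarrow> integrable lebesgue (g w)"
  shows "has_weak_deriv (word_index L) (\<lambda>x. f (B *v x)) (\<lambda>x. word_sum B L (\<lambda>w. g w (B *v x)))"
  unfolding has_weak_deriv_def mi_order_word_index
proof (intro conjI allI impI)
  have measurable: "h \<in> borel_measurable lebesgue" if "integrable lebesgue h" for h :: "real ^ 'n \<Rightarrow> real"
    using that by (rule borel_measurable_integrable)
  have fB: "integrable lebesgue (\<lambda>x. f (B *v x))"
    by (rule integrable_lebesgue_matrix[OF measurable[OF f] B f])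
  have gB: "integrable lebesgue (\<lambda>x. g w (B *v x))" if "length w = length L" for w
    using g_int[OF that] by (intro integrable_lebesgue_matrix B measurable)
  show "locally_integrable (\<lambda>x. f (B *v x))"
    by (rule integrable_imp_locally_integrable[OF fB])
  show "locally_integrable (\<lambda>x. word_sum B L (\<lambda>w. g w (B *v x)))"
    by (intro integrable_imp_locally_integrable integrable_word_sum gB)
  fix \<phi> :: "real ^ 'n \<Rightarrow> real" assume \<phi>: "test_function \<phi>"
  obtain C where C: "C ** B = mat 1" "B ** C = mat 1"
    using B by (auto simp: invertible_det_nz[symmetric] invertible_def)
  define \<psi> where "\<psi> x = \<phi> (C *v x)" for x
  have \<psi>: "test_function \<psi>"
    unfolding \<psi>_def using C by (intro test_function_compose_matrix \<phi>) (auto simp: invertible_def)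
  then have \<psi>_smooth: "smooth \<psi>" by (simp add: test_function_def)
  have \<phi>_eq: "\<phi> = (\<lambda>x. \<psi> (B *v x))"
    by (simp add: \<psi>_def matrix_vector_mul_assoc C)
  have \<phi>_smooth: "smooth \<phi>" using \<phi> by (simp add: test_function_def)
  have deriv: "multi_deriv (word_index L) \<phi> x = word_sum B L (\<lambda>w. iter_partial w \<psi> (B *v x))" for x
    unfolding multi_deriv_word_index[OF \<phi>_smooth]
    unfolding \<phi>_eq iter_partial_compose_matrix(1)[OF \<psi>_smooth] ..
  have int1: "integrable lebesgue (\<lambda>z. f z * iter_partial w \<psi> z)" for w
    by (intro integrable_mult_test_function integrable_imp_locally_integrable f test_function_iter_partial \<psi>)
  have int2: "integrable lebesgue (\<lambda>z. g w z * \<psi> z)" if "length w = length L" for w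
    by (intro integrable_mult_test_function integrable_imp_locally_integrable g_int that \<psi>)
  note int1' = integrable_word_sum[where L = L and B = B, OF int1]
  note int2' = integrable_word_sum[where L = L and B = B, OF int2]
  \<comment> \<open>The determinant is carried on both sides, each of which undergoes one
    substitution, and is cancelled at the end.\<close>
  have "\<bar>det B\<bar> * (LINT x|lebesgue. f (B *v x) * multi_deriv (word_index L) \<phi> x)
      = \<bar>det B\<bar> * (LINT x|lebesgue. word_sum B L (\<lambda>w. f (B *v x) * iter_partial w \<psi> (B *v x)))"
    by (simp add: deriv word_sum_scale)
  also have "\<dots> = (LINT z|lebesgue. word_sum B L (\<lambda>w. f z * iter_partial w \<psi> z))"
    by (rule integral_lebesgue_matrix[OF measurable[OF int1'] B, symmetric])
  also have "\<dots> = word_sum B L (\<lambda>w. LINT z|lebesgue. f z * iter_partial w \<psi> z)"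
    by (rule integral_word_sum[OF int1])
  also have "\<dots> = word_sum B L (\<lambda>w. (- 1) ^ length L * (LINT z|lebesgue. g w z * \<psi> z))"
  proof (rule word_sum_cong)
    fix w :: "'n list" assume w: "length w = length L"
    have "(LINT z|lebesgue. f z * multi_deriv (word_index w) \<psi> z)
        = (- 1) ^ mi_order (word_index w) * (LINT z|lebesgue. g w z * \<psi> z)"
      using g[OF w] \<psi> unfolding has_weak_deriv_def by blast
    then show "(LINT z|lebesgue. f z * iter_partial w \<psi> z) = (- 1) ^ length L * (LINT z|lebesgue. g w z * \<psi> z)"
      unfolding multi_deriv_word_index[OF \<psi>_smooth] mi_order_word_index w .
  qed
  also have "\<dots> = (- 1) ^ length L * (LINT z|lebesgue. word_sum B L (\<lambda>w. g w z * \<psi> z))"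
    by (simp add: word_sum_scale integral_word_sum int2)
  also have "(LINT z|lebesgue. word_sum B L (\<lambda>w. g w z * \<psi> z))
      = \<bar>det B\<bar> * (LINT x|lebesgue. word_sum B L (\<lambda>w. g w (B *v x) * \<psi> (B *v x)))"
    by (rule integral_lebesgue_matrix[OF measurable[OF int2'] B])
  also have "(\<lambda>x. word_sum B L (\<lambda>w. g w (B *v x) * \<psi> (B *v x))) = (\<lambda>x. word_sum B L (\<lambda>w. g w (B *v x)) * \<phi> x)"
    by (simp add: \<phi>_eq mult.commute[of _ "\<psi> _"] word_sum_scale)
  finally show "(LINT x|lebesgue. f (B *v x) * multi_deriv (word_index L) \<phi> x)
      = (- 1) ^ length L * (LINT x|lebesgue. word_sum B L (\<lambda>w. g w (B *v x)) * \<phi> x)"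
    using B by (simp add: mult.left_commute)
qed

section \<open>Chosen weak derivatives, Sobolev functions and the weight\<close>

lemma weak_D_AE_eq: "has_weak_deriv \<alpha> f g \<Longrightarrow> AE x in lebesgue. weak_D \<alpha> f x = g x"
  unfolding weak_D_def by (rule has_weak_deriv_unique[OF someI[of "has_weak_deriv \<alpha> f"]])

text \<open>The representative selected by \<open>weak_D\<close> need not be the integrable one
  provided by membership in the space; uniqueness up to null sets transfers measurability and
  integrability to it.\<close>

lemma sobolev_W1_weak_D:
  assumes "f \<in> sobolev_W1 k" "mi_order \<beta> \<le> k"
  shows "has_weak_deriv \<beta> f (weak_D \<beta> f)" and "integrable lebesgue (weak_D \<beta> f)"
proof -
  obtain g where g: "has_weak_deriv \<beta> f g" "integrable lebesgue g"
    using assms by (auto simp: sobolev_W1_def)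
  show "has_weak_deriv \<beta> f (weak_D \<beta> f)"
    unfolding weak_D_def using g(1) by (rule someI[of "has_weak_deriv \<beta> f"])
  have ae: "AE x in lebesgue. g x = weak_D \<beta> f x"
    using weak_D_AE_eq[OF g(1)] by eventually_elim simp
  have "weak_D \<beta> f \<in> borel_measurable lebesgue"
    by (rule borel_measurable_AE[OF borel_measurable_integrable[OF g(2)] ae])
  from integrable_cong_AE_imp[OF g(2) this] ae
  show "integrable lebesgue (weak_D \<beta> f)"
    by (auto elim!: eventually_mono)
qed

lemma sobolev_W1_integrable: "f \<in> sobolev_W1 k \<Longrightarrow> integrable lebesgue f"
  by (simp add: sobolev_W1_def)

text \<open>A sum over an infinite set is 0 by convention, so finiteness is what makes
  \<open>sobolev_norm\<close> dominate each of its terms.\<close>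

lemma finite_mi_order_le: "finite {\<alpha> :: nat ^ 'n. mi_order \<alpha> \<le> k}"
proof (rule finite_subset)
  show "{\<alpha> :: nat ^ 'n. mi_order \<alpha> \<le> k} \<subseteq> word_index ` {w. set w \<subseteq> UNIV \<and> length w \<le> k}"
  proof
    fix \<alpha> :: "nat ^ 'n" assume "\<alpha> \<in> {\<alpha>. mi_order \<alpha> \<le> k}"
    moreover obtain w where "word_index w = \<alpha>" using ex_word_index by blast
    ultimately show "\<alpha> \<in> word_index ` {w. set w \<subseteq> UNIV \<and> length w \<le> k}"
      using mi_order_word_index[of w] by auto
  qed
  show "finite (word_index ` {w. set w \<subseteq> (UNIV :: 'n set) \<and> length w \<le> k})"
    by (intro finite_imageI finite_lists_length_le) simp
qed

lemma power_le_one_plus_power: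
  fixes a :: real
  assumes "0 \<le> a" "m \<le> k"
  shows "a ^ m \<le> 1 + a ^ k"
proof (cases "a \<le> 1")
  case True
  then have "a ^ m \<le> 1" using assms by (simp add: power_le_one)
  then show ?thesis using assms by (simp add: add_increasing2)
next
  case False
  then have "a ^ m \<le> a ^ k" using assms by (intro power_increasing) auto
  then show ?thesis by simp
qed

text \<open>From a^m \<le> 1 + a^k it follows that 1 + a^m \<le> 2 + a^k \<le> 2 (1 + a^k), which is
  the origin of the factor 2. The comparison makes the results available for every order below
  k.\<close>

lemma hausdorff_weight_mono:
  assumes "m \<le> k"
  shows "hausdorff_weight m \<Phi> A y \<le> 2 * hausdorff_weight k \<Phi> A y"
proof -
  have "norm (A y) ^ m \<le> 1 + norm (A y) ^ k"
    by (rule power_le_one_plus_power[OF norm_ge_zero assms])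
  then have "1 + norm (A y) ^ m \<le> 2 + 2 * norm (A y) ^ k"
    using zero_le_power[OF norm_ge_zero[of "A y"], of k] by linarith
  then have "1 + norm (A y) ^ m \<le> 2 * (1 + norm (A y) ^ k)"
    by simp
  then have "inverse \<bar>det (A y)\<bar> * (1 + norm (A y) ^ m) * \<bar>\<Phi> y\<bar>
      \<le> inverse \<bar>det (A y)\<bar> * (2 * (1 + norm (A y) ^ k)) * \<bar>\<Phi> y\<bar>"
    by (intro mult_right_mono mult_left_mono) auto
  then have "ennreal (inverse \<bar>det (A y)\<bar> * (1 + norm (A y) ^ m) * \<bar>\<Phi> y\<bar>)
      \<le> ennreal (2 * (inverse \<bar>det (A y)\<bar> * (1 + norm (A y) ^ k) * \<bar>\<Phi> y\<bar>))"
    by (intro ennreal_leI) (simp only: mult_ac)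
  then have "ennreal (inverse \<bar>det (A y)\<bar> * (1 + norm (A y) ^ m) * \<bar>\<Phi> y\<bar>)
      \<le> 2 * ennreal (inverse \<bar>det (A y)\<bar> * (1 + norm (A y) ^ k) * \<bar>\<Phi> y\<bar>)"
    by (subst (asm) (2) ennreal_mult') simp_all
  then show ?thesis
    by (simp add: hausdorff_weight_def ennreal_mult_top)
qed

lemma borel_measurable_hausdorff_weight:
  fixes A :: "real ^ 'n \<Rightarrow> real ^ 'n ^ 'n"
  assumes [measurable]: "\<Phi> \<in> borel_measurable lebesgue" "A \<in> borel_measurable lebesgue"
  shows "hausdorff_weight k \<Phi> A \<in> borel_measurable lebesgue"
proof -
  have [measurable]: "(\<lambda>y. det (A y)) \<in> borel_measurable lebesgue"
    by (rule borel_measurable_det) measurable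
  show ?thesis
    unfolding hausdorff_weight_def[abs_def] by measurable
qed

text \<open>Integration of vectors by components. The entries are themselves allowed to be vectors,
  so two applications handle matrices.\<close>

lemma
  fixes F :: "'a \<Rightarrow> 'b::euclidean_space ^ 'm"
  assumes F: "\<And>i. integrable M (\<lambda>y. F y $ i)"
  shows integrable_vecI: "integrable M F"
    and integral_vec_nth: "(LINT y|M. F y) $ i = (LINT y|M. F y $ i)"
proof -
  have axis: "bounded_linear (\<lambda>v. axis i v :: 'b ^ 'm)" for i
    unfolding linear_conv_bounded_linear[symmetric]
    by (rule linearI) (simp_all add: axis_def vec_eq_iff)
  have "F = (\<lambda>y. \<Sum>i\<in>UNIV. axis i (F y $ i))"
    by (simp add: fun_eq_iff vec_eq_iff axis_def)
  moreover have "integrable M (\<lambda>y. \<Sum>i\<in>UNIV. axis i (F y $ i))"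
    by (intro Bochner_Integration.integrable_sum integrable_bounded_linear[OF axis] F)
  ultimately show "integrable M F"
    by simp
  then show "(LINT y|M. F y) $ i = (LINT y|M. F y $ i)"
    by (rule integral_bounded_linear[OF bounded_linear_vec_nth, symmetric])
qed

locale hausdorff_data =
  fixes \<Phi> :: "real ^ 'n \<Rightarrow> real" and A :: "real ^ 'n \<Rightarrow> real ^ 'n ^ 'n" and k :: nat
  assumes Phi_meas: "\<Phi> \<in> borel_measurable lebesgue"
    and A_meas: "A \<in> borel_measurable lebesgue"
    and finite_weight: "(\<integral>\<^sup>+ y. hausdorff_weight k \<Phi> A y \<partial>lebesgue) < \<infinity>"
begin

lemma hausdorff_data_mono:
  assumes "m \<le> k" shows "hausdorff_data \<Phi> A m"
proof
  have "(\<integral>\<^sup>+ y. hausdorff_weight m \<Phi> A y \<partial>lebesgue) \<le> (\<integral>\<^sup>+ y. 2 * hausdorff_weight k \<Phi> A y \<partial>lebesgue)"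
    by (intro nn_integral_mono hausdorff_weight_mono assms)
  also have "\<dots> = 2 * (\<integral>\<^sup>+ y. hausdorff_weight k \<Phi> A y \<partial>lebesgue)"
    by (intro nn_integral_cmult borel_measurable_hausdorff_weight Phi_meas A_meas)
  also have "\<dots> < \<infinity>"
    using finite_weight by (simp add: ennreal_mult_less_top)
  finally show "(\<integral>\<^sup>+ y. hausdorff_weight m \<Phi> A y \<partial>lebesgue) < \<infinity>" .
qed (rule Phi_meas A_meas)+

lemma AE_det_nonzero: "AE y in lebesgue. \<Phi> y \<noteq> 0 \<longrightarrow> det (A y) \<noteq> 0"
proof -
  have "AE y in lebesgue. hausdorff_weight k \<Phi> A y \<noteq> \<infinity>"
    using finite_weight by (intro nn_integral_PInf_AE borel_measurable_hausdorff_weight Phi_meas A_meas) simp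
  then show ?thesis
    by eventually_elim (auto simp: hausdorff_weight_def)
qed

text \<open>The pair is p = (y, x), and \<open>g w\<close> stands for the derivative of f along w.
  Leaving g general lets the empty word with \<open>\<lambda>_. f\<close> produce the integrand of
  the Hausdorff operator, so one integrability proof serves the function and its
  derivatives.\<close>

definition kernel :: "'n list \<Rightarrow> ('n list \<Rightarrow> real ^ 'n \<Rightarrow> real) \<Rightarrow> (real ^ 'n) \<times> (real ^ 'n) \<Rightarrow> real" where
  "kernel L g p = \<Phi> (fst p) * word_sum (A (fst p)) L (\<lambda>w. g w (A (fst p) *v snd p))"

lemma kernel_section_bound:
  fixes g :: "'n list \<Rightarrow> real ^ 'n \<Rightarrow> real"
  assumes g: "\<And>w. length w = length L \<Longrightarrow> integrable lebesgue (g w)" and L: "length L \<le> k"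
    and inv: "\<Phi> y \<noteq> 0 \<longrightarrow> det (A y) \<noteq> 0"
  shows "(\<integral>\<^sup>+x. ennreal \<bar>kernel L g (y, x)\<bar> \<partial>lebesgue)
    \<le> hausdorff_weight k \<Phi> A y * ennreal (\<Sum>w | length w = length L. LINT x|lebesgue. \<bar>g w x\<bar>)"
proof (cases "\<Phi> y = 0")
  case True
  then show ?thesis by (simp add: kernel_def)
next
  case False
  with inv have det: "det (A y) \<noteq> 0" by simp
  let ?W = "{w :: 'n list. length w = length L}"
  define S where "S = (\<Sum>w\<in>?W. LINT x|lebesgue. \<bar>g w x\<bar>)"
  define c where "c = \<bar>\<Phi> y\<bar> * norm (A y) ^ length L"
  have S: "0 \<le> S" unfolding S_def by (intro sum_nonneg) simp
  have c: "0 \<le> c" by (simp add: c_def)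
  have gA: "(\<lambda>x. g w (A y *v x)) \<in> borel_measurable lebesgue" if "w \<in> ?W" for w
    using g that by (intro borel_measurable_lebesgue_matrix det) auto
  have gA': "(\<lambda>x. ennreal \<bar>g w (A y *v x)\<bar>) \<in> borel_measurable lebesgue" if "w \<in> ?W" for w
    using gA[OF that] by measurable
  have "(\<integral>\<^sup>+x. ennreal \<bar>kernel L g (y, x)\<bar> \<partial>lebesgue)
      \<le> (\<integral>\<^sup>+x. ennreal c * (\<Sum>w\<in>?W. ennreal \<bar>g w (A y *v x)\<bar>) \<partial>lebesgue)"
  proof (rule nn_integral_mono)
    fix x
    have "\<bar>kernel L g (y, x)\<bar> \<le> \<bar>\<Phi> y\<bar> * (norm (A y) ^ length L * (\<Sum>w\<in>?W. \<bar>g w (A y *v x)\<bar>))"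
      unfolding kernel_def abs_mult fst_conv snd_conv by (intro mult_left_mono abs_word_sum_le) simp
    then have "ennreal \<bar>kernel L g (y, x)\<bar> \<le> ennreal (c * (\<Sum>w\<in>?W. \<bar>g w (A y *v x)\<bar>))"
      by (intro ennreal_leI) (simp add: c_def mult.assoc)
    also have "\<dots> = ennreal c * (\<Sum>w\<in>?W. ennreal \<bar>g w (A y *v x)\<bar>)"
      using c by (simp add: ennreal_mult' sum_ennreal)
    finally show "ennreal \<bar>kernel L g (y, x)\<bar> \<le> ennreal c * (\<Sum>w\<in>?W. ennreal \<bar>g w (A y *v x)\<bar>)" .
  qed
  also have "\<dots> = ennreal c * (\<Sum>w\<in>?W. \<integral>\<^sup>+x. ennreal \<bar>g w (A y *v x)\<bar> \<partial>lebesgue)"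
    by (subst nn_integral_cmult, intro borel_measurable_sum gA', assumption, subst nn_integral_sum, erule gA', rule refl)
  also have "\<dots> = ennreal c * (\<Sum>w\<in>?W. ennreal (inverse \<bar>det (A y)\<bar>) * ennreal (LINT x|lebesgue. \<bar>g w x\<bar>))"
  proof (intro arg_cong2[of _ _ _ _ "(*)"] sum.cong refl)
    fix w assume "w \<in> ?W"
    then have gw: "integrable lebesgue (g w)" using g by simp
    show "(\<integral>\<^sup>+x. ennreal \<bar>g w (A y *v x)\<bar> \<partial>lebesgue) = ennreal (inverse \<bar>det (A y)\<bar>) * ennreal (LINT x|lebesgue. \<bar>g w x\<bar>)"
      unfolding nn_integral_lebesgue_matrix[OF borel_measurable_integrable[OF gw] det]
      using nn_integral_eq_integral[OF integrable_abs[OF gw]] by simp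
  qed
  also have "\<dots> = ennreal (c * inverse \<bar>det (A y)\<bar>) * ennreal S"
    using c S_def by (simp add: sum_distrib_left[symmetric] sum_ennreal ennreal_mult' mult.assoc)
  also have "\<dots> \<le> hausdorff_weight k \<Phi> A y * ennreal S"
  proof (rule mult_right_mono)
    \<comment> \<open>The weight contains only the exponent k; its summand 1 covers lower orders
      where the matrix norm is below 1.\<close>
    have "norm (A y) ^ length L \<le> 1 + norm (A y) ^ k"
      by (rule power_le_one_plus_power[OF norm_ge_zero L])
    then have "c * inverse \<bar>det (A y)\<bar> \<le> inverse \<bar>det (A y)\<bar> * (1 + norm (A y) ^ k) * \<bar>\<Phi> y\<bar>"
      by (simp add: c_def mult_left_mono mult_right_mono mult_ac)
    then show "ennreal (c * inverse \<bar>det (A y)\<bar>) \<le> hausdorff_weight k \<Phi> A y"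
      using False det by (simp add: hausdorff_weight_def ennreal_leI)
  qed simp
  finally show ?thesis unfolding S_def .
qed

lemma kernel_measurable:
  assumes "\<And>w. length w = length L \<Longrightarrow> integrable lebesgue (g w)"
  shows "kernel L g \<in> borel_measurable lebesgue"
  unfolding kernel_def[abs_def] using assms
  by (intro borel_measurable_word_sum_dilation A_meas Phi_meas AE_det_nonzero) auto

lemma
  assumes g: "\<And>w. length w = length L \<Longrightarrow> integrable lebesgue (g w)" and L: "length L \<le> k"
  shows kernel_integrable: "integrable lebesgue (kernel L g)"
    and kernel_norm_bound: "(LINT p|lebesgue. \<bar>kernel L g p\<bar>)
      \<le> enn2real (\<integral>\<^sup>+ y. hausdorff_weight k \<Phi> A y \<partial>lebesgue)
        * (\<Sum>w | length w = length L. LINT x|lebesgue. \<bar>g w x\<bar>)"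
proof -
  define S where "S = (\<Sum>w | length w = length L. LINT x|lebesgue. \<bar>g w x\<bar>)"
  define W where "W = (\<integral>\<^sup>+ y. hausdorff_weight k \<Phi> A y \<partial>lebesgue)"
  have S: "0 \<le> S" unfolding S_def by (intro sum_nonneg) simp
  \<comment> \<open>\<open>enn2real\<close> sends infinity to 0, so finiteness of the weight
    integral is needed for the real constant to represent it.\<close>
  have W: "W = ennreal (enn2real W)"
    using finite_weight by (simp add: W_def)
  have meas: "kernel L g \<in> borel_measurable lebesgue"
    by (rule kernel_measurable[OF g])
  have "(\<integral>\<^sup>+p. ennreal \<bar>kernel L g p\<bar> \<partial>lebesgue) = (\<integral>\<^sup>+y. \<integral>\<^sup>+x. ennreal \<bar>kernel L g (y, x)\<bar> \<partial>lebesgue \<partial>lebesgue)"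
    by (rule nn_integral_lebesgue_pair[OF meas])
  also have "\<dots> \<le> (\<integral>\<^sup>+y. hausdorff_weight k \<Phi> A y * ennreal S \<partial>lebesgue)"
  proof (rule nn_integral_mono_AE)
    show "AE y in lebesgue. (\<integral>\<^sup>+x. ennreal \<bar>kernel L g (y, x)\<bar> \<partial>lebesgue) \<le> hausdorff_weight k \<Phi> A y * ennreal S"
      using AE_det_nonzero unfolding S_def by eventually_elim (rule kernel_section_bound[OF g L])
  qed
  also have "\<dots> = W * ennreal S"
    unfolding W_def by (intro nn_integral_multc borel_measurable_hausdorff_weight Phi_meas A_meas)
  also have "\<dots> = ennreal (enn2real W * S)"
    using W S by (metis ennreal_mult' enn2real_nonneg)
  finally have bound: "(\<integral>\<^sup>+p. ennreal \<bar>kernel L g p\<bar> \<partial>lebesgue) \<le> ennreal (enn2real W * S)" .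
  show int: "integrable lebesgue (kernel L g)"
    using meas bound by (intro integrableI_bounded) (auto simp: less_top[symmetric] top_unique)
  have "ennreal (LINT p|lebesgue. \<bar>kernel L g p\<bar>) \<le> ennreal (enn2real W * S)"
    using bound nn_integral_eq_integral[OF integrable_abs[OF int]] by simp
  then have "(LINT p|lebesgue. \<bar>kernel L g p\<bar>) \<le> enn2real W * S"
    using S by (subst (asm) ennreal_le_iff) auto
  then show "(LINT p|lebesgue. \<bar>kernel L g p\<bar>) \<le> enn2real (\<integral>\<^sup>+ y. hausdorff_weight k \<Phi> A y \<partial>lebesgue)
        * (\<Sum>w | length w = length L. LINT x|lebesgue. \<bar>g w x\<bar>)"
    unfolding W_def S_def .
qed

end

section \<open>Derivatives of the Hausdorff operator\<close>

context hausdorff_data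
begin

lemma kernel_Nil: "kernel [] (\<lambda>_. f) (y, x) = \<Phi> y * f (A y *v x)"
  by (simp add: kernel_def)

lemma hausdorff_eq_kernel: "hausdorff \<Phi> A f x = (LINT y|lebesgue. kernel [] (\<lambda>_. f) (y, x))"
  by (simp add: kernel_Nil hausdorff_def)

lemma hausdorff_kernel_integrable:
  "integrable lebesgue f \<Longrightarrow> integrable lebesgue (kernel [] (\<lambda>_. f))"
  by (rule kernel_integrable) simp_all

lemma
  assumes "integrable lebesgue f"
  shows hausdorff_converges: "hausdorff_converges \<Phi> A f"
    and hausdorff_integrable: "integrable lebesgue (hausdorff \<Phi> A f)"
  using Fubini_lebesgue_snd(1,2)[OF hausdorff_kernel_integrable[OF assms]]
  by (simp_all add: hausdorff_converges_def kernel_Nil hausdorff_def[abs_def])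

context
  fixes f :: "real ^ 'n \<Rightarrow> real" and L :: "'n list"
  assumes f: "f \<in> sobolev_W1 k" and L: "length L \<le> k"
begin

abbreviation D where "D w \<equiv> weak_D (word_index w) f"

lemmas f_integrable = sobolev_W1_integrable[OF f]

lemma D_weak_deriv: "length w \<le> k \<Longrightarrow> has_weak_deriv (word_index w) f (D w)"
  and D_integrable: "length w \<le> k \<Longrightarrow> integrable lebesgue (D w)"
  using sobolev_W1_weak_D[OF f] by (simp_all add: mi_order_word_index)

lemma kernel_D_integrable: "integrable lebesgue (kernel L D)"
  by (rule kernel_integrable[OF D_integrable L]) (use L in simp)

lemma dilation_has_weak_deriv:
  "AE y in lebesgue. \<Phi> y \<noteq> 0 \<longrightarrow>
    has_weak_deriv (word_index L) (\<lambda>x. f (A y *v x)) (\<lambda>x. word_sum (A y) L (\<lambda>w. D w (A y *v x)))"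
  using AE_det_nonzero
proof eventually_elim
  case (elim y)
  show ?case
  proof
    assume "\<Phi> y \<noteq> 0"
    with elim show "has_weak_deriv (word_index L) (\<lambda>x. f (A y *v x)) (\<lambda>x. word_sum (A y) L (\<lambda>w. D w (A y *v x)))"
      using L by (intro has_weak_deriv_compose_matrix f_integrable D_weak_deriv D_integrable) auto
  qed
qed

text \<open>For almost every fixed y with nonzero \<Phi> the required identity is the weak
  derivative of one dilation. Test functions and their derivatives are bounded, so multiplying the
  kernels by them keeps joint integrability, and the order of integration can be exchanged both
  before and after this identity is used.\<close>

lemma has_weak_deriv_hausdorff:
  "has_weak_deriv (word_index L) (hausdorff \<Phi> A f) (\<lambda>x. LINT y|lebesgue. kernel L D (y, x))"
  unfolding has_weak_deriv_def mi_order_word_index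
proof (intro conjI allI impI)
  show "locally_integrable (hausdorff \<Phi> A f)"
    by (intro integrable_imp_locally_integrable hausdorff_integrable f_integrable)
  show "locally_integrable (\<lambda>x. LINT y|lebesgue. kernel L D (y, x))"
    by (intro integrable_imp_locally_integrable Fubini_lebesgue_snd(2) kernel_D_integrable)
  fix \<phi> :: "real ^ 'n \<Rightarrow> real" assume \<phi>: "test_function \<phi>"
  define d where "d = multi_deriv (word_index L) \<phi>"
  have d: "test_function d"
    unfolding d_def using \<phi> by (subst multi_deriv_word_index) (auto simp: test_function_iter_partial, simp add: test_function_def)
  have mult: "integrable lebesgue (\<lambda>p. F p * \<psi> (snd p))"
    if F: "integrable lebesgue F" and \<psi>: "test_function \<psi>" for F :: "(real ^ 'n) \<times> (real ^ 'n) \<Rightarrow> real" and \<psi>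
  proof -
    obtain C where "\<And>x. \<bar>\<psi> x\<bar> \<le> C"
      using test_function_bounded[OF \<psi>] by blast
    then show ?thesis
      by (intro integrable_mult_bounded[OF F, of _ C] borel_measurable_lebesgue_snd test_function_measurable \<psi>)
  qed
  note int1 = mult[OF hausdorff_kernel_integrable[OF f_integrable] d]
  note int2 = mult[OF kernel_D_integrable \<phi>]
  have "(LINT x|lebesgue. hausdorff \<Phi> A f x * d x) = (LINT x|lebesgue. LINT y|lebesgue. kernel [] (\<lambda>_. f) (y, x) * d x)"
    by (simp add: hausdorff_eq_kernel)
  also have "\<dots> = (LINT y|lebesgue. LINT x|lebesgue. kernel [] (\<lambda>_. f) (y, x) * d x)"
    using Fubini_lebesgue_snd(3)[OF int1] Fubini_lebesgue_fst(3)[OF int1] by simp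
  also have "\<dots> = (LINT y|lebesgue. (- 1) ^ length L * (LINT x|lebesgue. kernel L D (y, x) * \<phi> x))"
  proof (rule integral_cong_AE)
    show "(\<lambda>y. LINT x|lebesgue. kernel [] (\<lambda>_. f) (y, x) * d x) \<in> borel_measurable lebesgue"
      using borel_measurable_integrable[OF Fubini_lebesgue_fst(2)[OF int1]] by simp
    show "(\<lambda>y. (- 1) ^ length L * (LINT x|lebesgue. kernel L D (y, x) * \<phi> x)) \<in> borel_measurable lebesgue"
      using borel_measurable_integrable[OF Fubini_lebesgue_fst(2)[OF int2]] by simp
    show "AE y in lebesgue. (LINT x|lebesgue. kernel [] (\<lambda>_. f) (y, x) * d x)
        = (- 1) ^ length L * (LINT x|lebesgue. kernel L D (y, x) * \<phi> x)"
      using dilation_has_weak_deriv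
    proof eventually_elim
      case (elim y)
      show ?case
      proof (cases "\<Phi> y = 0")
        case True
        then show ?thesis by (simp add: kernel_def)
      next
        case False
        with elim \<phi> have "(LINT x|lebesgue. f (A y *v x) * d x)
            = (- 1) ^ length L * (LINT x|lebesgue. word_sum (A y) L (\<lambda>w. D w (A y *v x)) * \<phi> x)"
          unfolding has_weak_deriv_def mi_order_word_index d_def by blast
        then show ?thesis
          by (simp add: kernel_def mult.assoc)
      qed
    qed
  qed
  also have "\<dots> = (- 1) ^ length L * (LINT y|lebesgue. LINT x|lebesgue. kernel L D (y, x) * \<phi> x)"
    by simp
  also have "(LINT y|lebesgue. LINT x|lebesgue. kernel L D (y, x) * \<phi> x)
      = (LINT x|lebesgue. LINT y|lebesgue. kernel L D (y, x) * \<phi> x)"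
    using Fubini_lebesgue_snd(3)[OF int2] Fubini_lebesgue_fst(3)[OF int2] by simp
  finally show "(LINT x|lebesgue. hausdorff \<Phi> A f x * multi_deriv (word_index L) \<phi> x)
      = (- 1) ^ length L * (LINT x|lebesgue. (LINT y|lebesgue. kernel L D (y, x)) * \<phi> x)"
    by (simp add: d_def)
qed

lemma weak_D_hausdorff:
  "AE x in lebesgue. weak_D (word_index L) (hausdorff \<Phi> A f) x = (LINT y|lebesgue. kernel L D (y, x))"
  by (rule weak_D_AE_eq[OF has_weak_deriv_hausdorff])

text \<open>The kernel bound sums over words rather than multi-indices. There are n^m words of
  length m, where n is the dimension, and each contributes at most the full Sobolev norm.\<close>

lemma weak_D_hausdorff_norm:
  "(LINT x|lebesgue. \<bar>weak_D (word_index L) (hausdorff \<Phi> A f) x\<bar>)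
    \<le> enn2real (\<integral>\<^sup>+ y. hausdorff_weight k \<Phi> A y \<partial>lebesgue) * (real CARD('n) ^ length L * sobolev_norm k f)"
proof -
  note F = Fubini_lebesgue_snd[OF kernel_D_integrable] and F' = Fubini_lebesgue_snd[OF integrable_abs[OF kernel_D_integrable]]
  have meas: "weak_D (word_index L) (hausdorff \<Phi> A f) \<in> borel_measurable lebesgue"
    by (rule borel_measurable_AE[OF borel_measurable_integrable[OF F(2)]])
       (use weak_D_hausdorff in eventually_elim, simp)
  have "(LINT x|lebesgue. \<bar>weak_D (word_index L) (hausdorff \<Phi> A f) x\<bar>) = (LINT x|lebesgue. \<bar>LINT y|lebesgue. kernel L D (y, x)\<bar>)"
    using weak_D_hausdorff meas borel_measurable_integrable[OF F(2)]
    by (intro integral_cong_AE) (auto elim!: eventually_mono)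
  also have "\<dots> \<le> (LINT x|lebesgue. LINT y|lebesgue. \<bar>kernel L D (y, x)\<bar>)"
    by (intro integral_mono integrable_abs F(2) F'(2) integral_abs_bound)
  also have "\<dots> = (LINT p|lebesgue. \<bar>kernel L D p\<bar>)"
    by (rule F'(3))
  also have "\<dots> \<le> enn2real (\<integral>\<^sup>+ y. hausdorff_weight k \<Phi> A y \<partial>lebesgue)
        * (\<Sum>w | length w = length L. LINT x|lebesgue. \<bar>D w x\<bar>)"
    by (rule kernel_norm_bound[OF D_integrable L]) (use L in simp)
  also have "\<dots> \<le> enn2real (\<integral>\<^sup>+ y. hausdorff_weight k \<Phi> A y \<partial>lebesgue) * (real CARD('n) ^ length L * sobolev_norm k f)"
  proof (rule mult_left_mono)
    have "(LINT x|lebesgue. \<bar>D w x\<bar>) \<le> sobolev_norm k f" if "length w = length L" for w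
      unfolding sobolev_norm_def
      by (rule member_le_sum) (use that L in \<open>auto simp: mi_order_word_index finite_mi_order_le\<close>)
    then have "(\<Sum>w | length w = length L. LINT x|lebesgue. \<bar>D w x\<bar>)
        \<le> of_nat (card {w :: 'n list. length w = length L}) * sobolev_norm k f"
      by (intro sum_bounded_above) simp
    then show "(\<Sum>w | length w = length L. LINT x|lebesgue. \<bar>D w x\<bar>) \<le> real CARD('n) ^ length L * sobolev_norm k f"
      by (simp add: card_words)
  qed simp
  finally show ?thesis .
qed

text \<open>The chain-rule formula is itself an admissible version, so claims about all versions are
  not vacuous.\<close>

lemma dilated_deriv_version_chain:
  "dilated_deriv_version \<Phi> A (word_index L) f
    (\<lambda>y x. apply_symbol (chain_symbol (A y) (word_index L)) f (A y *v x))"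
proof -
  have "kernel L D = (\<lambda>(y, x). \<Phi> y * word_sum (A y) L (\<lambda>w. D w (A y *v x)))"
    by (auto simp: kernel_def)
  then show ?thesis
    using borel_measurable_integrable[OF kernel_D_integrable] dilation_has_weak_deriv
    by (simp add: dilated_deriv_version_def apply_symbol_chain_symbol)
qed

text \<open>Uniqueness gives equality for almost every x at almost every fixed y, with a null set
  depending on y. Joint measurability makes the exceptional pairs a null set, whose sections at
  fixed x are again null for almost every x.\<close>

lemma dilated_deriv_version_AE_eq:
  assumes G: "dilated_deriv_version \<Phi> A (word_index L) f G"
  shows "AE x in lebesgue. AE y in lebesgue. \<Phi> y * G y x = kernel L D (y, x)"
proof -
  have G_meas: "(\<lambda>p. \<Phi> (fst p) * G (fst p) (snd p)) \<in> borel_measurable lebesgue"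
    using G by (simp add: dilated_deriv_version_def split_beta')
  have "AE p in lebesgue. \<Phi> (fst p) * G (fst p) (snd p) - kernel L D p = 0"
  proof (rule AE_lebesgue_pairI)
    show "(\<lambda>p. \<Phi> (fst p) * G (fst p) (snd p) - kernel L D p) \<in> borel_measurable lebesgue"
      by (rule borel_measurable_diff[OF G_meas borel_measurable_integrable[OF kernel_D_integrable]])
    have "AE y in lebesgue. \<Phi> y \<noteq> 0 \<longrightarrow> has_weak_deriv (word_index L) (\<lambda>x. f (A y *v x)) (G y)"
      using G by (simp add: dilated_deriv_version_def)
    with dilation_has_weak_deriv
    show "AE y in lebesgue. AE x in lebesgue. \<Phi> (fst (y, x)) * G (fst (y, x)) (snd (y, x)) - kernel L D (y, x) = 0"
    proof eventually_elim
      case (elim y)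
      show ?case
      proof (cases "\<Phi> y = 0")
        case False
        with elim have "AE x in lebesgue. G y x = word_sum (A y) L (\<lambda>w. D w (A y *v x))"
          by (intro has_weak_deriv_unique[of "word_index L" "\<lambda>x. f (A y *v x)"]) simp_all
        then show ?thesis
          by eventually_elim (simp add: kernel_def)
      qed (simp add: kernel_def)
    qed
  qed
  from AE_lebesgue_pair(2)[OF this] show ?thesis by simp
qed

lemma dilated_deriv_version_integral:
  assumes G: "dilated_deriv_version \<Phi> A (word_index L) f G"
  shows "AE x in lebesgue. integrable lebesgue (\<lambda>y. \<Phi> y * G y x)
    \<and> (LINT y|lebesgue. \<Phi> y * G y x) = (LINT y|lebesgue. kernel L D (y, x))"
proof -
  have G_meas: "(\<lambda>p. \<Phi> (fst p) * G (fst p) (snd p)) \<in> borel_measurable lebesgue"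
    using G by (simp add: dilated_deriv_version_def split_beta')
  show ?thesis
    using dilated_deriv_version_AE_eq[OF G] Fubini_lebesgue_snd(1)[OF kernel_D_integrable]
  proof eventually_elim
    case (elim x)
    have ae: "AE y in lebesgue. kernel L D (y, x) = \<Phi> y * G y x"
      using elim(1) by eventually_elim simp
    have meas: "(\<lambda>y. \<Phi> y * G y x) \<in> borel_measurable lebesgue"
      by (rule borel_measurable_AE[OF borel_measurable_integrable[OF elim(2)] ae])
    show ?case
      using integrable_cong_AE_imp[OF elim(2) meas ae] integral_cong_AE[OF meas borel_measurable_integrable[OF elim(2)] elim(1)]
      by simp
  qed
qed

end

section \<open>Boundedness, derivative formulas, gradient and Hessian\<close>

lemma hausdorff_in_sobolev_W1:
  assumes f: "f \<in> sobolev_W1 k"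
  shows "hausdorff \<Phi> A f \<in> sobolev_W1 k"
  unfolding sobolev_W1_def
proof (intro CollectI conjI allI impI)
  show "integrable lebesgue (hausdorff \<Phi> A f)"
    by (intro hausdorff_integrable sobolev_W1_integrable[OF f])
  fix \<alpha> :: "nat ^ 'n" assume "mi_order \<alpha> \<le> k"
  moreover obtain L where \<alpha>: "\<alpha> = word_index L"
    using ex_word_index by metis
  ultimately have L: "length L \<le> k"
    by (simp add: mi_order_word_index)
  show "\<exists>g. has_weak_deriv \<alpha> (hausdorff \<Phi> A f) g \<and> integrable lebesgue g"
    unfolding \<alpha> using has_weak_deriv_hausdorff[OF f L] Fubini_lebesgue_snd(2)[OF kernel_D_integrable[OF f L]]
    by blast
qed

text \<open>With W the integral of the weight and n the dimension, the constant is the sum of W n^m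
  over the multi-indices of order m at most k, and hence the same for all f.\<close>

lemma hausdorff_bounded: "hausdorff_bounded_on_W1 k \<Phi> A"
  unfolding hausdorff_bounded_on_W1_def
proof (intro conjI ballI exI)
  fix f :: "real ^ 'n \<Rightarrow> real" assume f: "f \<in> sobolev_W1 k"
  show "hausdorff_converges \<Phi> A f"
    by (intro hausdorff_converges sobolev_W1_integrable[OF f])
  show "hausdorff \<Phi> A f \<in> sobolev_W1 k"
    by (rule hausdorff_in_sobolev_W1[OF f])
  let ?W = "enn2real (\<integral>\<^sup>+ y. hausdorff_weight k \<Phi> A y \<partial>lebesgue)"
  have "sobolev_norm k (hausdorff \<Phi> A f)
      \<le> (\<Sum>\<alpha> :: nat ^ 'n | mi_order \<alpha> \<le> k. ?W * (real CARD('n) ^ mi_order \<alpha> * sobolev_norm k f))"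
    unfolding sobolev_norm_def[of k "hausdorff \<Phi> A f"]
  proof (rule sum_mono)
    fix \<alpha> :: "nat ^ 'n" assume "\<alpha> \<in> {\<alpha>. mi_order \<alpha> \<le> k}"
    moreover obtain L where \<alpha>: "\<alpha> = word_index L"
      using ex_word_index by metis
    ultimately have L: "length L \<le> k"
      by (simp add: mi_order_word_index)
    show "(LINT x|lebesgue. \<bar>weak_D \<alpha> (hausdorff \<Phi> A f) x\<bar>) \<le> ?W * (real CARD('n) ^ mi_order \<alpha> * sobolev_norm k f)"
      unfolding \<alpha> mi_order_word_index by (rule weak_D_hausdorff_norm[OF f L])
  qed
  also have "\<dots> = (\<Sum>\<alpha> :: nat ^ 'n | mi_order \<alpha> \<le> k. ?W * real CARD('n) ^ mi_order \<alpha>) * sobolev_norm k f"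
    by (simp add: sum_distrib_right mult.assoc)
  finally show "sobolev_norm k (hausdorff \<Phi> A f)
      \<le> (\<Sum>\<alpha> :: nat ^ 'n | mi_order \<alpha> \<le> k. ?W * real CARD('n) ^ mi_order \<alpha>) * sobolev_norm k f" .
qed

lemma hausdorff_derivatives:
  assumes f: "f \<in> sobolev_W1 k" and \<alpha>: "mi_order \<alpha> \<le> k"
  shows "dilated_deriv_version \<Phi> A \<alpha> f (\<lambda>y x. apply_symbol (chain_symbol (A y) \<alpha>) f (A y *v x))
    \<and> (\<forall>G. dilated_deriv_version \<Phi> A \<alpha> f G \<longrightarrow>
        (AE x in lebesgue.
           integrable lebesgue (\<lambda>y. \<Phi> y * G y x)
         \<and> integrable lebesgue (\<lambda>y. \<Phi> y * apply_symbol (chain_symbol (A y) \<alpha>) f (A y *v x))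
         \<and> weak_D \<alpha> (hausdorff \<Phi> A f) x = (LINT y|lebesgue. \<Phi> y * G y x)
         \<and> (LINT y|lebesgue. \<Phi> y * G y x) =
             (LINT y|lebesgue. \<Phi> y * apply_symbol (chain_symbol (A y) \<alpha>) f (A y *v x))))"
proof -
  obtain L where eq: "\<alpha> = word_index L"
    using ex_word_index by metis
  then have L: "length L \<le> k"
    using \<alpha> by (simp add: mi_order_word_index)
  note chain = dilated_deriv_version_chain[OF f L]
  note chain_int = dilated_deriv_version_integral[OF f L chain]
  show ?thesis
    unfolding eq
  proof (intro conjI allI impI)
    fix G assume "dilated_deriv_version \<Phi> A (word_index L) f G"
    note dilated_deriv_version_integral[OF f L this]
    with chain_int weak_D_hausdorff[OF f L]
    show "AE x in lebesgue.
           integrable lebesgue (\<lambda>y. \<Phi> y * G y x)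
         \<and> integrable lebesgue (\<lambda>y. \<Phi> y * apply_symbol (chain_symbol (A y) (word_index L)) f (A y *v x))
         \<and> weak_D (word_index L) (hausdorff \<Phi> A f) x = (LINT y|lebesgue. \<Phi> y * G y x)
         \<and> (LINT y|lebesgue. \<Phi> y * G y x) =
             (LINT y|lebesgue. \<Phi> y * apply_symbol (chain_symbol (A y) (word_index L)) f (A y *v x))"
      by eventually_elim simp
  qed (rule chain)
qed

lemma hausdorff_word_derivative:
  assumes f: "f \<in> sobolev_W1 k" and L: "length L \<le> k"
  shows "AE x in lebesgue.
      integrable lebesgue (\<lambda>y. \<Phi> y * word_sum (A y) L (\<lambda>w. weak_D (word_index w) f (A y *v x)))
    \<and> weak_D (word_index L) (hausdorff \<Phi> A f) x
      = (LINT y|lebesgue. \<Phi> y * word_sum (A y) L (\<lambda>w. weak_D (word_index w) f (A y *v x)))"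
  using Fubini_lebesgue_snd(1)[OF kernel_D_integrable[OF f L]] weak_D_hausdorff[OF f L]
  by eventually_elim (simp add: kernel_def)

text \<open>The i-th component of the row vector product is the expansion along the one-letter word
  \<open>[i]\<close>.\<close>

lemma hausdorff_gradient:
  assumes f: "f \<in> sobolev_W1 k" and k: "1 \<le> k"
  shows "AE x in lebesgue.
      integrable lebesgue (\<lambda>y. \<Phi> y *\<^sub>R (weak_grad f (A y *v x) v* A y))
    \<and> weak_grad (hausdorff \<Phi> A f) x = (LINT y|lebesgue. \<Phi> y *\<^sub>R (weak_grad f (A y *v x) v* A y))"
proof -
  have comp: "(\<Phi> y *\<^sub>R (weak_grad f z v* A y)) $ i = \<Phi> y * word_sum (A y) [i] (\<lambda>w. weak_D (word_index w) f z)" for y z i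
    by (simp add: vector_matrix_mult_def weak_grad_def word_index_Cons mult.commute)
  have "AE x in lebesgue. \<forall>i. integrable lebesgue (\<lambda>y. (\<Phi> y *\<^sub>R (weak_grad f (A y *v x) v* A y)) $ i)
      \<and> weak_D (word_index [i]) (hausdorff \<Phi> A f) x = (LINT y|lebesgue. (\<Phi> y *\<^sub>R (weak_grad f (A y *v x) v* A y)) $ i)"
    unfolding AE_all_countable comp using k by (intro allI hausdorff_word_derivative f) simp
  then show ?thesis
  proof eventually_elim
    case (elim x)
    then have int: "integrable lebesgue (\<lambda>y. (\<Phi> y *\<^sub>R (weak_grad f (A y *v x) v* A y)) $ i)" for i
      by blast
    have "weak_grad (hausdorff \<Phi> A f) x $ i = (LINT y|lebesgue. \<Phi> y *\<^sub>R (weak_grad f (A y *v x) v* A y)) $ i" for i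
      unfolding integral_vec_nth[OF int] using elim by (simp add: weak_grad_def word_index_Cons)
    then show ?case
      using integrable_vecI[OF int] by (simp add: vec_eq_iff)
  qed
qed

text \<open>The (i, j) entry of the congruence is the sum over p and q of a_pi a_qj times the
  derivative in directions p and q, that is, the expansion along the two-letter word
  \<open>[i, j]\<close>.\<close>

lemma hausdorff_hessian:
  assumes f: "f \<in> sobolev_W1 k" and k: "2 \<le> k"
  shows "AE x in lebesgue.
      integrable lebesgue (\<lambda>y. \<Phi> y *\<^sub>R (transpose (A y) ** weak_hessian f (A y *v x) ** A y))
    \<and> weak_hessian (hausdorff \<Phi> A f) x
      = (LINT y|lebesgue. \<Phi> y *\<^sub>R (transpose (A y) ** weak_hessian f (A y *v x) ** A y))"
proof -
  define F where "F x y = \<Phi> y *\<^sub>R (transpose (A y) ** weak_hessian f (A y *v x) ** A y)" for x y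
  have comp: "F x y $ i $ j = \<Phi> y * word_sum (A y) [i, j] (\<lambda>w. weak_D (word_index w) f (A y *v x))" for x y i j
  proof -
    have "(transpose (A y) ** weak_hessian f z ** A y) $ i $ j
        = (\<Sum>q\<in>UNIV. \<Sum>p\<in>UNIV. A y $ p $ i * (A y $ q $ j * weak_hessian f z $ p $ q))" for z
      by (simp add: matrix_matrix_mult_def transpose_def sum_distrib_left mult_ac)
    also have "\<dots> z = (\<Sum>p\<in>UNIV. A y $ p $ i * (\<Sum>q\<in>UNIV. A y $ q $ j * weak_hessian f z $ p $ q))" for z
      by (subst sum.swap) (simp add: sum_distrib_left)
    finally show ?thesis
      by (simp add: F_def weak_hessian_def word_index_Cons add.commute)
  qed
  have "AE x in lebesgue. \<forall>i j. integrable lebesgue (\<lambda>y. F x y $ i $ j)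
      \<and> weak_D (word_index [i, j]) (hausdorff \<Phi> A f) x = (LINT y|lebesgue. F x y $ i $ j)"
    unfolding AE_all_countable comp using k by (intro allI hausdorff_word_derivative f) simp
  then have "AE x in lebesgue. integrable lebesgue (F x)
      \<and> weak_hessian (hausdorff \<Phi> A f) x = (LINT y|lebesgue. F x y)"
  proof eventually_elim
    case (elim x)
    then have int: "integrable lebesgue (\<lambda>y. F x y $ i $ j)" for i j
      by blast
    note int' = integrable_vecI[OF int]
    have "weak_hessian (hausdorff \<Phi> A f) x $ i $ j = (LINT y|lebesgue. F x y) $ i $ j" for i j
      unfolding integral_vec_nth[OF int'] integral_vec_nth[OF int] using elim
      by (simp add: weak_hessian_def word_index_Cons add.commute)
    then show ?case
      using integrable_vecI[OF int'] by (simp add: vec_eq_iff)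
  qed
  then show ?thesis
    unfolding F_def .
qed

end

theorem theorem1p1:
  fixes \<Phi> :: "real ^ 'n \<Rightarrow> real"
    and A :: "real ^ 'n \<Rightarrow> real ^ 'n ^ 'n"
    and k :: nat
  assumes Phi_meas: "\<Phi> \<in> borel_measurable lebesgue"
    and A_meas: "A \<in> borel_measurable lebesgue"
    and finite_weight: "(\<integral>\<^sup>+ y. hausdorff_weight k \<Phi> A y \<partial>lebesgue) < \<infinity>"
  shows "hausdorff_bounded_on_W1 k \<Phi> A
    \<and> (\<forall>f\<in>sobolev_W1 k. \<forall>\<alpha>. mi_order \<alpha> \<le> k \<longrightarrow>
         dilated_deriv_version \<Phi> A \<alpha> f
           (\<lambda>y x. apply_symbol (chain_symbol (A y) \<alpha>) f (A y *v x))
       \<and> (\<forall>G. dilated_deriv_version \<Phi> A \<alpha> f G \<longrightarrow>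
            (AE x in lebesgue.
               integrable lebesgue (\<lambda>y. \<Phi> y * G y x)
             \<and> integrable lebesgue
                 (\<lambda>y. \<Phi> y * apply_symbol (chain_symbol (A y) \<alpha>) f (A y *v x))
             \<and> weak_D \<alpha> (hausdorff \<Phi> A f) x = (LINT y|lebesgue. \<Phi> y * G y x)
             \<and> (LINT y|lebesgue. \<Phi> y * G y x) =
                 (LINT y|lebesgue.
                    \<Phi> y * apply_symbol (chain_symbol (A y) \<alpha>) f (A y *v x)))))
    \<and> (1 \<le> k \<longrightarrow> (\<forall>f\<in>sobolev_W1 1.
         hausdorff_converges \<Phi> A f \<and> hausdorff \<Phi> A f \<in> sobolev_W1 1
       \<and> (AE x in lebesgue.
            integrable lebesgue (\<lambda>y. \<Phi> y *\<^sub>R (weak_grad f (A y *v x) v* A y))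
          \<and> weak_grad (hausdorff \<Phi> A f) x =
              (LINT y|lebesgue. \<Phi> y *\<^sub>R (weak_grad f (A y *v x) v* A y)))))
    \<and> (2 \<le> k \<longrightarrow> (\<forall>f\<in>sobolev_W1 2.
         hausdorff_converges \<Phi> A f \<and> hausdorff \<Phi> A f \<in> sobolev_W1 2
       \<and> (AE x in lebesgue.
            integrable lebesgue
              (\<lambda>y. \<Phi> y *\<^sub>R (transpose (A y) ** weak_hessian f (A y *v x) ** A y))
          \<and> weak_hessian (hausdorff \<Phi> A f) x =
              (LINT y|lebesgue.
                 \<Phi> y *\<^sub>R (transpose (A y) ** weak_hessian f (A y *v x) ** A y)))))"
proof -
  interpret hausdorff_data \<Phi> A k
    by standard (fact Phi_meas A_meas finite_weight)+
  have "hausdorff_converges \<Phi> A f \<and> hausdorff \<Phi> A f \<in> sobolev_W1 1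
       \<and> (AE x in lebesgue.
            integrable lebesgue (\<lambda>y. \<Phi> y *\<^sub>R (weak_grad f (A y *v x) v* A y))
          \<and> weak_grad (hausdorff \<Phi> A f) x =
              (LINT y|lebesgue. \<Phi> y *\<^sub>R (weak_grad f (A y *v x) v* A y)))"
    if "1 \<le> k" "f \<in> sobolev_W1 1" for f
  proof -
    \<comment> \<open>Here f lies only in the space of order 1, so the results are taken for order
      1, with the weight hypothesis passed down from k.\<close>
    interpret one: hausdorff_data \<Phi> A 1
      using that(1) by (rule hausdorff_data_mono)
    show ?thesis
      using that(2) by (intro conjI one.hausdorff_converges one.hausdorff_in_sobolev_W1 one.hausdorff_gradient sobolev_W1_integrable) auto
  qed
  moreover have "hausdorff_converges \<Phi> A f \<and> hausdorff \<Phi> A f \<in> sobolev_W1 2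
       \<and> (AE x in lebesgue.
            integrable lebesgue
              (\<lambda>y. \<Phi> y *\<^sub>R (transpose (A y) ** weak_hessian f (A y *v x) ** A y))
          \<and> weak_hessian (hausdorff \<Phi> A f) x =
              (LINT y|lebesgue.
                 \<Phi> y *\<^sub>R (transpose (A y) ** weak_hessian f (A y *v x) ** A y)))"
    if "2 \<le> k" "f \<in> sobolev_W1 2" for f
  proof -
    interpret two: hausdorff_data \<Phi> A 2
      using that(1) by (rule hausdorff_data_mono)
    show ?thesis
      using that(2) by (intro conjI two.hausdorff_converges two.hausdorff_in_sobolev_W1 two.hausdorff_hessian sobolev_W1_integrable) auto
  qed
  ultimately show ?thesis
    using hausdorff_bounded hausdorff_derivatives by blast
qed

end
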